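(* In the SSS scheme with equiprobable rectangular $M_I\times M_Q$ QAM and transmit powers $P_0,P_1>0$ over Rayleigh fading (i.e. $|h|^2$ has density $e^{-x}$, $x\ge0$), the average symbol error probability of the optimal (maximum a posteriori) detector is $$\begin{aligned}\mathrm{SEP}(P)=\sum_{k=0}^{1}\Pr\{\hat{\mathcal H}_k\}\Bigg\{&\Pr\{\mathcal H_0|\hat{\mathcal H}_k\}\Big[\big(2-\tfrac1{M_I}-\tfrac1{M_Q}\big)\big(1-\tfrac1{\beta_{0,k}}\big)\\ &\quad-2\big(1-\tfrac1{M_I}\big)\big(1-\tfrac1{M_Q}\big)\Big(\tfrac{2}{\pi}\tfrac{1}{\beta_{0,k}}\tan^{-1}\big(\tfrac1{\beta_{0,k}}\big)-\tfrac1{\beta_{0,k}}+\tfrac12\Big)\Big]\\ +&\Pr\{\mathcal H_1|\hat{\mathcal H}_k\}\Big[\big(2-\tfrac1{M_I}-\tfrac1{M_Q}\big)\sum_{l=1}^p\lambda_l\big(1-\tfrac1{\beta_{1,k,l}}\big)\\ &\quad-2\big(1-\tfrac1{M_I}\big)\big(1-\tfrac1{M_Q}\big)\sum_{l=1}^p\lambda_l\Big(\tfrac{2}{\pi}\tfrac{1}{\beta_{1,k,l}}\tan^{-1}\big(\tfrac1{\beta_{1,k,l}}\big)-\tfrac1{\beta_{1,k,l}}+\tfrac12\Big)\Big]\Bigg\},\end{aligned}$$ where $$\beta_{0,k}=\sqrt{1+\tfrac{2}{3P_k}(M_I^2+M_Q^2-2)\sigma_n^2},\qquad \beta_{1,k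,l}=\sqrt{1+\tfrac{2}{3P_k}(M_I^2+M_Q^2-2)(\sigma_l^2+\sigma_n^2)}.$$
   Context: Setting (cognitive radio with imperfect sensing). The true channel state is $\mathcal H_0$ (primary user idle) or $\mathcal H_1$ (primary user active), with given prior probabilities. The sensing decision is $\hat{\mathcal H}_0$ (idle) or $\hat{\mathcal H}_1$ (busy), with $P_{\rm d}=\Pr\{\hat{\mathcal H}_1|\mathcal H_1\}$ and $P_{\rm f}=\Pr\{\hat{\mathcal H}_1|\mathcal H_0\}$. The quantities $\Pr\{\hat{\mathcal H}_k\}$ and $\Pr\{\mathcal H_j|\hat{\mathcal H}_k\}$ follow by total probability and Bayes' rule; assume $\Pr\{\hat{\mathcal H}_k\}>0$ for both $k$. In the sensing-based spectrum sharing (SSS) scheme the secondary user transmits with power $P_k$ under decision $\hat{\mathcal H}_k$, $k=0,1$. Constellation. $M_I,M_Q\ge1$ are integers with $M=M_IM_Q\ge 2$. Under $\hat{\mathcal H}_k$ the transmitted symbol is uniform on the points $s_{n,q}=s_n+js_q$ with $$s_n=(2n+1-M_I)\tfrac{d_{min,k}}{2}\ (0\le n\le M_I-1),\qquad s_q=(2q+1-M_Q)\tfrac{d_{min,k}}{2}\ (0\le q\le M_Q-1),$$ $$d_{min,k}=\sqrt{\tfrac{12P_k}{M_I^2+M_Q^2-2}}.$$ Channel. The received signal is $y=hs+n$ under $\mathcal H_0$ and $y=hs+n+w$ under $\mathcal H_1$. The noise $n$ has density $\frac{1}{2\pi\sigma_n^2}e^{-|n|^2/(2\sigma_n^2)}$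 on $\mathbb C$ ($\sigma_n^2>0$). The primary interference $w$ has Gaussian mixture density $\sum_{l=1}^p\frac{\lambda_l}{2\pi\sigma_l^2}e^{-|w|^2/(2\sigma_l^2)}$, with $\sigma_l^2>0$, $\lambda_l\ge0$, $\sum_l\lambda_l=1$. The variables $n$ and $w$ are independent of each other. Given the sensing decision and the true state, they are also independent of the transmitted symbol. The fading $h$ is independent of the channel state, sensing decision, transmitted symbol, noise and interference. Detector. Knowing $\hat{\mathcal H}_k$, $h$ and $y$, the receiver outputs a constellation point maximizing $\Pr\{\mathcal H_0|\hat{\mathcal H}_k\}f(y|s,h,\hat{\mathcal H}_k,\mathcal H_0)+\Pr\{\mathcal H_1|\hat{\mathcal H}_k\}f(y|s,h,\hat{\mathcal H}_k,\mathcal H_1)$, where $f(y|s,h,\hat{\mathcal H}_k,\mathcal H_j)$ is the conditional density of $y$. $\mathrm{SEP}(P)$ is the probability that the output differs from the transmitted symbol, averaged over symbol, sensing decision, true state and $h$. *)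

theory Defs
  imports "HOL-Probability.Probability"
begin

text \<open>Hypotheses are indexed by natural numbers: 0 stands for idle, 1 for active (true state)
  or busy (sensing decision). The index j is used for the true state, k for the decision.\<close>

section \<open>Sensing probabilities\<close>

definition sensing_prob :: "real \<Rightarrow> real \<Rightarrow> nat \<Rightarrow> nat \<Rightarrow> real" where
  "sensing_prob Pd Pf k j =
     (let p = (if j = 1 then Pd else Pf) in if k = 1 then p else 1 - p)"

text \<open>The probability of decision k (total probability) and the posterior probability of state j
  given decision k (Bayes' rule).\<close>

definition decision_prob :: "(nat \<Rightarrow> real) \<Rightarrow> real \<Rightarrow> real \<Rightarrow> nat \<Rightarrow> real" where
  "decision_prob prior Pd Pf k = (\<Sum>j\<in>{0,1}. prior j * sensing_prob Pd Pf k j)"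

definition posterior :: "(nat \<Rightarrow> real) \<Rightarrow> real \<Rightarrow> real \<Rightarrow> nat \<Rightarrow> nat \<Rightarrow> real" where
  "posterior prior Pd Pf j k = prior j * sensing_prob Pd Pf k j / decision_prob prior Pd Pf k"

section \<open>Rectangular QAM\<close>

definition qam_dmin :: "nat \<Rightarrow> nat \<Rightarrow> real \<Rightarrow> real" where
  "qam_dmin MI MQ Pk = sqrt (12 * Pk / ((real MI)\<^sup>2 + (real MQ)\<^sup>2 - 2))"

definition qam_coord :: "nat \<Rightarrow> real \<Rightarrow> nat \<Rightarrow> real" where
  "qam_coord m d n = (2 * real n + 1 - real m) * (d / 2)"

definition qam_constellation :: "nat \<Rightarrow> nat \<Rightarrow> real \<Rightarrow> complex set" where
  "qam_constellation MI MQ Pk =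
     {Complex (qam_coord MI (qam_dmin MI MQ Pk) n) (qam_coord MQ (qam_dmin MI MQ Pk) q) | n q.
        n < MI \<and> q < MQ}"

section \<open>Channel\<close>

text \<open>Here v is the variance per real dimension.\<close>

definition cgauss_density :: "real \<Rightarrow> complex \<Rightarrow> real" where
  "cgauss_density v z = 1 / (2 * pi * v) * exp (- (cmod z)\<^sup>2 / (2 * v))"

definition cgauss_mixture_density ::
    "nat \<Rightarrow> (nat \<Rightarrow> real) \<Rightarrow> (nat \<Rightarrow> real) \<Rightarrow> complex \<Rightarrow> real" where
  "cgauss_mixture_density p lam \<sigma> z = (\<Sum>l=1..p. lam l * cgauss_density ((\<sigma> l)\<^sup>2) z)"

definition received ::
    "('a \<Rightarrow> nat) \<Rightarrow> ('a \<Rightarrow> complex) \<Rightarrow> ('a \<Rightarrow> complex) \<Rightarrow> ('a \<Rightarrow> complex) \<Rightarrow> ('a \<Rightarrow> complex) \<Rightarrow>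
     'a \<Rightarrow> complex" where
  "received H S h N W \<omega> =
     (if H \<omega> = 0 then h \<omega> * S \<omega> + N \<omega> else h \<omega> * S \<omega> + N \<omega> + W \<omega>)"

text \<open>The probability space conditioned on true state j and decision k. It is a probability
  space only if that event has positive probability, hence the guards below.\<close>

abbreviation cond_space ::
    "'a measure \<Rightarrow> ('a \<Rightarrow> nat) \<Rightarrow> ('a \<Rightarrow> nat) \<Rightarrow> nat \<Rightarrow> nat \<Rightarrow> 'a measure" where
  "cond_space M H D j k \<equiv> uniform_measure M {\<omega> \<in> space M. H \<omega> = j \<and> D \<omega> = k}"

text \<open>Same as the library's \<^term>\<open>prob_space.indep_var\<close>, which requires both random variables to
  have the same value type.\<close>

definition indep_rvs ::
    "'a measure \<Rightarrow> 'b measure \<Rightarrow> ('a \<Rightarrow> 'b) \<Rightarrow> 'c measure \<Rightarrow> ('a \<Rightarrow> 'c) \<Rightarrow> bool" where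
  "indep_rvs M A X B Y \<longleftrightarrow> X \<in> measurable M A \<and> Y \<in> measurable M B \<and>
     prob_space.indep_set M {X -` U \<inter> space M | U. U \<in> sets A} {Y -` V \<inter> space M | V. V \<in> sets B}"

locale sss_qam_rayleigh = prob_space M
  for M :: "'a measure" +
  fixes prior :: "nat \<Rightarrow> real" and Pd Pf :: real
    and MI MQ :: nat and P :: "nat \<Rightarrow> real"
    and \<sigma>n :: real and p :: nat and lam \<sigma> :: "nat \<Rightarrow> real"
    and H D :: "'a \<Rightarrow> nat"
    and S h N W :: "'a \<Rightarrow> complex"
  assumes prior: "prior 0 \<ge> 0" "prior 1 \<ge> 0" "prior 0 + prior 1 = 1"
    and Pd: "0 \<le> Pd" "Pd \<le> 1" and Pf: "0 \<le> Pf" "Pf \<le> 1"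
    and decision_prob_pos: "\<And>k. k \<in> {0,1} \<Longrightarrow> decision_prob prior Pd Pf k > 0"
    and MI: "MI \<ge> 1" and MQ: "MQ \<ge> 1" and M_ge_2: "MI * MQ \<ge> 2"
    and power_pos: "\<And>k. k \<in> {0,1} \<Longrightarrow> P k > 0"
    and noise_var_pos: "\<sigma>n\<^sup>2 > 0"
    and mixture_var_pos: "\<And>l. l \<in> {1..p} \<Longrightarrow> (\<sigma> l)\<^sup>2 > 0"
    and mixture_weight_nonneg: "\<And>l. l \<in> {1..p} \<Longrightarrow> lam l \<ge> 0"
    and mixture_weight_sum: "(\<Sum>l=1..p. lam l) = 1"
    and H_rv: "H \<in> measurable M (count_space {0,1})"
    and D_rv: "D \<in> measurable M (count_space {0,1})"
    and S_rv: "S \<in> borel_measurable M"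
    and h_rv: "h \<in> borel_measurable M"
    and N_rv: "N \<in> borel_measurable M"
    and W_rv: "W \<in> borel_measurable M"
    and state_decision: "\<And>j k. j \<in> {0,1} \<Longrightarrow> k \<in> {0,1} \<Longrightarrow>
      prob {\<omega> \<in> space M. H \<omega> = j \<and> D \<omega> = k} = prior j * sensing_prob Pd Pf k j"
    and symbol_uniform: "\<And>j k s. j \<in> {0,1} \<Longrightarrow> k \<in> {0,1} \<Longrightarrow>
      prob {\<omega> \<in> space M. H \<omega> = j \<and> D \<omega> = k} > 0 \<Longrightarrow> s \<in> qam_constellation MI MQ (P k) \<Longrightarrow>
      measure (cond_space M H D j k) {\<omega> \<in> space M. S \<omega> = s} = 1 / (real MI * real MQ)"
    and noise_distr: "\<And>j k. j \<in> {0,1} \<Longrightarrow> k \<in> {0,1} \<Longrightarrow>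
      prob {\<omega> \<in> space M. H \<omega> = j \<and> D \<omega> = k} > 0 \<Longrightarrow>
      distributed (cond_space M H D j k) lborel N (\<lambda>z. ennreal (cgauss_density (\<sigma>n\<^sup>2) z))"
    and interference_distr: "\<And>j k. j \<in> {0,1} \<Longrightarrow> k \<in> {0,1} \<Longrightarrow>
      prob {\<omega> \<in> space M. H \<omega> = j \<and> D \<omega> = k} > 0 \<Longrightarrow>
      distributed (cond_space M H D j k) lborel W (\<lambda>z. ennreal (cgauss_mixture_density p lam \<sigma> z))"
    and noise_interference_indep: "\<And>j k. j \<in> {0,1} \<Longrightarrow> k \<in> {0,1} \<Longrightarrow>
      prob {\<omega> \<in> space M. H \<omega> = j \<and> D \<omega> = k} > 0 \<Longrightarrow>
      prob_space.indep_var (cond_space M H D j k) borel N borel W"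
    and symbol_indep: "\<And>j k. j \<in> {0,1} \<Longrightarrow> k \<in> {0,1} \<Longrightarrow>
      prob {\<omega> \<in> space M. H \<omega> = j \<and> D \<omega> = k} > 0 \<Longrightarrow>
      indep_rvs (cond_space M H D j k)
        borel S (borel \<Otimes>\<^sub>M borel) (\<lambda>\<omega>. (N \<omega>, W \<omega>))"
    and fading_indep: "indep_rvs M borel h
      (count_space {0,1} \<Otimes>\<^sub>M count_space {0,1} \<Otimes>\<^sub>M borel \<Otimes>\<^sub>M borel \<Otimes>\<^sub>M borel)
      (\<lambda>\<omega>. (H \<omega>, D \<omega>, S \<omega>, N \<omega>, W \<omega>))"
    and rayleigh: "distributed M lborel (\<lambda>\<omega>. (cmod (h \<omega>))\<^sup>2)
      (\<lambda>x. ennreal (if x \<ge> 0 then exp (- x) else 0))"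

text \<open>The sensing probabilities computed from the prior, Pd and Pf are the ones of the model.\<close>

lemma (in sss_qam_rayleigh) prob_decision:
  assumes k: "k \<in> {0,1}"
  shows "prob {\<omega> \<in> space M. D \<omega> = k} = decision_prob prior Pd Pf k"
proof -
  have sets: "{\<omega> \<in> space M. H \<omega> = j \<and> D \<omega> = k} \<in> sets M" if "j \<in> {0,1}" for j
  proof -
    have "{\<omega> \<in> space M. H \<omega> = j \<and> D \<omega> = k} = (H -` {j} \<inter> space M) \<inter> (D -` {k} \<inter> space M)"
      by auto
    then show ?thesis
      using measurable_sets[OF H_rv, of "{j}"] measurable_sets[OF D_rv, of "{k}"] that k by auto
  qed
  have "{\<omega> \<in> space M. D \<omega> = k} =
      {\<omega> \<in> space M. H \<omega> = 0 \<and> D \<omega> = k} \<union> {\<omega> \<in> space M. H \<omega> = 1 \<and> D \<omega> = k}"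
    using measurable_space[OF H_rv] by auto
  then have "prob {\<omega> \<in> space M. D \<omega> = k} =
      prob {\<omega> \<in> space M. H \<omega> = 0 \<and> D \<omega> = k} + prob {\<omega> \<in> space M. H \<omega> = 1 \<and> D \<omega> = k}"
    using finite_measure_Union[OF sets[of 0] sets[of 1]] by (simp add: disjoint_iff)
  then show ?thesis
    using state_decision[OF _ k] by (simp add: decision_prob_def)
qed

lemma (in sss_qam_rayleigh) cond_prob_state:
  assumes "j \<in> {0,1}" "k \<in> {0,1}"
  shows "cond_prob M (\<lambda>\<omega>. H \<omega> = j) (\<lambda>\<omega>. D \<omega> = k) = posterior prior Pd Pf j k"
  using assms by (simp add: cond_prob_def posterior_def prob_decision state_decision)

section \<open>Detector and symbol error probability\<close>

text \<open>The function f k j s g y is a version of the conditional density of the received signal y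
  given decision k, state j, symbol s and fading g: given decision, state and symbol, the joint law
  of fading and received signal has density f with respect to (law of the fading) times Lebesgue
  measure. Any version is admitted.\<close>

definition is_received_cond_density ::
    "'a measure \<Rightarrow> nat \<Rightarrow> nat \<Rightarrow> (nat \<Rightarrow> real) \<Rightarrow> ('a \<Rightarrow> nat) \<Rightarrow> ('a \<Rightarrow> nat) \<Rightarrow>
     ('a \<Rightarrow> complex) \<Rightarrow> ('a \<Rightarrow> complex) \<Rightarrow> ('a \<Rightarrow> complex) \<Rightarrow> ('a \<Rightarrow> complex) \<Rightarrow>
     (nat \<Rightarrow> nat \<Rightarrow> complex \<Rightarrow> complex \<Rightarrow> complex \<Rightarrow> real) \<Rightarrow> bool" where
  "is_received_cond_density M MI MQ P H D S h N W f \<longleftrightarrow>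
     (\<forall>k\<in>{0,1}. \<forall>j\<in>{0,1}. \<forall>s\<in>qam_constellation MI MQ (P k).
        let E = {\<omega> \<in> space M. D \<omega> = k \<and> H \<omega> = j \<and> S \<omega> = s}; C = uniform_measure M E in
        measure M E > 0 \<longrightarrow>
        distributed C (distr C borel h \<Otimes>\<^sub>M lborel)
          (\<lambda>\<omega>. (h \<omega>, received H S h N W \<omega>)) (\<lambda>(g, y). ennreal (f k j s g y)))"

text \<open>The value detector k g y is the output for decision k, fading g and received signal y.\<close>

definition is_map_detector ::
    "(nat \<Rightarrow> real) \<Rightarrow> real \<Rightarrow> real \<Rightarrow> nat \<Rightarrow> nat \<Rightarrow> (nat \<Rightarrow> real) \<Rightarrow>
     (nat \<Rightarrow> nat \<Rightarrow> complex \<Rightarrow> complex \<Rightarrow> complex \<Rightarrow> real) \<Rightarrow>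
     (nat \<Rightarrow> complex \<Rightarrow> complex \<Rightarrow> complex) \<Rightarrow> bool" where
  "is_map_detector prior Pd Pf MI MQ P f detector \<longleftrightarrow>
     (\<forall>k\<in>{0,1}. \<forall>g y.
        is_arg_max
          (\<lambda>s. posterior prior Pd Pf 0 k * f k 0 s g y + posterior prior Pd Pf 1 k * f k 1 s g y)
          (\<lambda>s. s \<in> qam_constellation MI MQ (P k))
          (detector k g y))"

definition SEP ::
    "'a measure \<Rightarrow> ('a \<Rightarrow> nat) \<Rightarrow> ('a \<Rightarrow> nat) \<Rightarrow>
     ('a \<Rightarrow> complex) \<Rightarrow> ('a \<Rightarrow> complex) \<Rightarrow> ('a \<Rightarrow> complex) \<Rightarrow> ('a \<Rightarrow> complex) \<Rightarrow>
     (nat \<Rightarrow> complex \<Rightarrow> complex \<Rightarrow> complex) \<Rightarrow> real" where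
  "SEP M H D S h N W detector =
     measure M {\<omega> \<in> space M. detector (D \<omega>) (h \<omega>) (received H S h N W \<omega>) \<noteq> S \<omega>}"

text \<open>Here v is the total variance of noise and interference.\<close>

definition qam_beta :: "nat \<Rightarrow> nat \<Rightarrow> real \<Rightarrow> real \<Rightarrow> real" where
  "qam_beta MI MQ Pk v = sqrt (1 + 2 / (3 * Pk) * ((real MI)\<^sup>2 + (real MQ)\<^sup>2 - 2) * v)"

end

theory Submission
  imports Defs
begin

text \<open>The total noise (noise alone, or noise plus interference) is in both states a finite mixture of
  circularly symmetric Gaussians, hence its density is strictly decreasing in the distance from the
  origin. Whatever the posterior, a MAP detector therefore decides almost surely for a nearest point
  of the scaled constellation. Division by the fading coefficient rotates the decision regions into
  axis-parallel rectangles and changes only the Gaussian variances, so the probability of a correct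
  decision is a product of two expressions linear in the Gaussian tail \<open>T\<close> at \<open>c * \<bar>h\<bar>\<close>.
  Averaging over \<open>\<bar>h\<bar>\<^sup>2\<close>, which is exponentially distributed, needs only the means of \<open>T\<close> and \<open>T\<^sup>2\<close>;
  both follow from Tonelli's theorem, since \<open>T\<^sup>2\<close> is again an integral over \<open>{t..}\<close>. Ties between
  nearest points need no treatment: the open and the closed rectangles have the same probability.\<close>

section \<open>The Gaussian tail and its Rayleigh averages\<close>

text \<open>\<open>gauss_tail\<close> is the Q-function. The shape of the proof is dictated by how
  little the model fixes pointwise: \<open>f\<close> is any version of the conditional densities,
  unconstrained for a state and decision that have joint probability zero, and only the composed
  output of the detector is known to be measurable. So statements about the detector hold almost
  everywhere for the law of \<open>h\<close> times Lebesgue measure, terms of impossible pairs are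
  removed by a posterior equal to 0, and decision regions are replaced by measurable sets of pairs
  of fading and noise. The origin of the beta terms: for spacing \<open>d\<close> and variance
  \<open>v\<close> the tail is taken at \<open>c * |h|\<close> with
  \<open>c = d / (2 * sqrt v)\<close>. Exchanging integrals leaves the normal density damped by
  \<open>exp (- (z / c)^2)\<close>, up to a factor a normal density of variance
  \<open>1 / b^2\<close>, where \<open>b^2 = 1 + 2 / c^2\<close>; with the QAM spacing inserted,
  \<open>b\<close> is the beta of the theorem. In the result, \<open>1 - 1 / b\<close> is twice the
  mean of the tail, and the bracket with the arctangent is twice the mean of its square.\<close>

definition gauss_tail :: "real \<Rightarrow> real" where
  "gauss_tail c = measure (density lborel std_normal_density) {c..}"

lemma ennreal_gauss_tail:
  "ennreal (gauss_tail c) = (\<integral>\<^sup>+z. ennreal (std_normal_density z) * indicator {c..} z \<partial>lborel)"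
proof -
  interpret prob_space "density lborel std_normal_density"
    by (rule prob_space_normal_density) simp
  show ?thesis
    unfolding gauss_tail_def emeasure_eq_measure[symmetric] by (simp add: emeasure_density)
qed

lemma gauss_tail_nonneg: "0 \<le> gauss_tail c"
  by (simp add: gauss_tail_def)

lemma gauss_tail_le_1: "gauss_tail c \<le> 1"
proof -
  interpret prob_space "density lborel std_normal_density"
    by (rule prob_space_normal_density) simp
  show ?thesis by (simp add: gauss_tail_def)
qed

lemma gauss_tail_mono: "x \<le> y \<Longrightarrow> gauss_tail y \<le> gauss_tail x"
proof -
  interpret prob_space "density lborel std_normal_density"
    by (rule prob_space_normal_density) simp
  show "x \<le> y \<Longrightarrow> gauss_tail y \<le> gauss_tail x"
    unfolding gauss_tail_def by (intro finite_measure_mono) auto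
qed

lemma borel_measurable_gauss_tail [measurable]: "gauss_tail \<in> borel_measurable borel"
proof -
  \<comment> \<open>The tail is antitone, so measurability of monotone functions is applied to its
    negation.\<close>
  have "(\<lambda>x. - (- gauss_tail x)) \<in> borel_measurable borel"
    by (intro borel_measurable_uminus borel_measurable_mono monoI) (simp add: gauss_tail_mono)
  then show ?thesis by simp
qed

lemma nn_integral_normal_density:
  assumes "0 < s" shows "(\<integral>\<^sup>+x. ennreal (normal_density m s x) \<partial>lborel) = 1"
  using assms by (simp add: nn_integral_eq_integral)

lemma nn_integral_normal_atLeast:
  assumes t: "0 < t"
  shows "(\<integral>\<^sup>+x. ennreal (normal_density 0 t x) * indicator {a..} x \<partial>lborel) = gauss_tail (a / t)"
proof -
  have "(\<integral>\<^sup>+x. ennreal (normal_density 0 t x) * indicator {a..} x \<partial>lborel) =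
    ennreal t * (\<integral>\<^sup>+x. ennreal (normal_density 0 t (0 + t * x)) * indicator {a..} (0 + t * x) \<partial>lborel)"
    using t by (subst nn_integral_real_affine[where c=t and t=0]) simp_all
  also have "\<dots> = (\<integral>\<^sup>+x. ennreal (std_normal_density x) * indicator {a / t..} x \<partial>lborel)"
  proof (subst nn_integral_cmult[symmetric], simp, intro nn_integral_cong)
    fix x
    have "t * normal_density 0 t (t * x) = std_normal_density x"
      using t by (simp add: normal_density_def power_mult_distrib real_sqrt_mult field_simps)
    moreover have "indicator {a..} (0 + t * x) = (indicator {a / t..} x :: ennreal)"
      using t by (auto simp: indicator_def field_simps)
    ultimately show "ennreal t * (ennreal (normal_density 0 t (0 + t * x)) * indicator {a..} (0 + t * x))
        = ennreal (std_normal_density x) * indicator {a / t..} x"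
      using t by (simp add: mult.assoc[symmetric] ennreal_mult[symmetric])
  qed
  finally show ?thesis by (simp add: ennreal_gauss_tail)
qed

text \<open>Substituting $z_2 = z u$ makes the inner integral over $z$ elementary.\<close>

lemma nn_integral_exp_gauss_tail:
  assumes a: "0 < a"
  shows "(\<integral>\<^sup>+z. ennreal (exp (- a * z\<^sup>2 / 2) / sqrt (2 * pi) * gauss_tail z) * indicator {0..} z \<partial>lborel)
    = ennreal ((pi / 2 - arctan (1 / sqrt a)) / (2 * pi * sqrt a))"
proof -
  have tail: "ennreal (gauss_tail z) = (\<integral>\<^sup>+u. ennreal (z * std_normal_density (z * u)) * indicator {1..} u \<partial>lborel)"
    if z: "0 < z" for z
  proof -
    have "ennreal (gauss_tail z) = ennreal z * (\<integral>\<^sup>+u. ennreal (std_normal_density (0 + z * u)) * indicator {z..} (0 + z * u) \<partial>lborel)"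
      unfolding ennreal_gauss_tail using z by (subst nn_integral_real_affine[where c=z and t=0]) simp_all
    also have "\<dots> = (\<integral>\<^sup>+u. ennreal (z * std_normal_density (z * u)) * indicator {1..} u \<partial>lborel)"
      using z by (subst nn_integral_cmult[symmetric]) (auto intro!: nn_integral_cong simp: indicator_def ennreal_mult)
    finally show ?thesis .
  qed
  have "(\<integral>\<^sup>+z. ennreal (exp (- a * z\<^sup>2 / 2) / sqrt (2 * pi) * gauss_tail z) * indicator {0..} z \<partial>lborel)
    = (\<integral>\<^sup>+z. (\<integral>\<^sup>+u. ennreal (z * exp (- (a + u\<^sup>2) * z\<^sup>2 / 2) / (2 * pi)) * indicator {0..} z * indicator {1..} u \<partial>lborel) \<partial>lborel)"
  proof (rule nn_integral_cong_AE)
    \<comment> \<open>The substitution by a multiple of \<open>z\<close> breaks down at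
      \<open>z = 0\<close>, which is a null set.\<close>
    have "AE z in lborel. z \<noteq> (0::real)" by (rule AE_lborel_singleton)
    then show "AE z in lborel. ennreal (exp (- a * z\<^sup>2 / 2) / sqrt (2 * pi) * gauss_tail z) * indicator {0..} z =
      (\<integral>\<^sup>+u. ennreal (z * exp (- (a + u\<^sup>2) * z\<^sup>2 / 2) / (2 * pi)) * indicator {0..} z * indicator {1..} u \<partial>lborel)"
    proof eventually_elim
      fix z :: real assume z0: "z \<noteq> 0"
      show "ennreal (exp (- a * z\<^sup>2 / 2) / sqrt (2 * pi) * gauss_tail z) * indicator {0..} z =
        (\<integral>\<^sup>+u. ennreal (z * exp (- (a + u\<^sup>2) * z\<^sup>2 / 2) / (2 * pi)) * indicator {0..} z * indicator {1..} u \<partial>lborel)"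
      proof (cases "0 < z")
        case True
        have "ennreal (exp (- a * z\<^sup>2 / 2) / sqrt (2 * pi) * gauss_tail z) =
          (\<integral>\<^sup>+u. ennreal (exp (- a * z\<^sup>2 / 2) / sqrt (2 * pi)) * (ennreal (z * std_normal_density (z * u)) * indicator {1..} u) \<partial>lborel)"
          by (subst nn_integral_cmult) (simp_all add: tail[OF True, symmetric] ennreal_mult[symmetric] gauss_tail_nonneg)
        also have "\<dots> = (\<integral>\<^sup>+u. ennreal (z * exp (- (a + u\<^sup>2) * z\<^sup>2 / 2) / (2 * pi)) * indicator {1..} u \<partial>lborel)"
        proof (rule nn_integral_cong)
          fix u
          have "exp (- a * z\<^sup>2 / 2) * exp (- (z * u)\<^sup>2 / 2) = exp (- (a + u\<^sup>2) * z\<^sup>2 / 2)"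
            unfolding exp_add[symmetric] by (simp add: field_simps power_mult_distrib)
          then have "exp (- a * z\<^sup>2 / 2) / sqrt (2 * pi) * (z * std_normal_density (z * u)) =
              z * exp (- (a + u\<^sup>2) * z\<^sup>2 / 2) / (2 * pi)"
            by (simp add: std_normal_density_def)
          then show "ennreal (exp (- a * z\<^sup>2 / 2) / sqrt (2 * pi)) * (ennreal (z * std_normal_density (z * u)) * indicator {1..} u)
            = ennreal (z * exp (- (a + u\<^sup>2) * z\<^sup>2 / 2) / (2 * pi)) * indicator {1..} u"
            using True by (simp add: mult.assoc[symmetric] ennreal_mult''[symmetric])
        qed
        finally show ?thesis using True by simp
      qed (use z0 in simp)
    qed
  qed
  also have "\<dots> = (\<integral>\<^sup>+u. (\<integral>\<^sup>+z. ennreal (z * exp (- (a + u\<^sup>2) * z\<^sup>2 / 2) / (2 * pi)) * indicator {0..} z * indicator {1..} u \<partial>lborel) \<partial>lborel)"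
    by (rule lborel_pair.Fubini') simp
  also have "\<dots> = (\<integral>\<^sup>+u. ennreal (1 / (2 * pi * (a + u\<^sup>2))) * indicator {1..} u \<partial>lborel)"
  proof (rule nn_integral_cong)
    fix u :: real
    have b: "0 < a + u\<^sup>2" using a by (simp add: add_pos_nonneg)
    let ?b = "a + u\<^sup>2"
    have "(\<integral>\<^sup>+z. ennreal (z * exp (- ?b * z\<^sup>2 / 2) / (2 * pi)) * indicator {0..} z \<partial>lborel) =
      ennreal (0 - (- exp (- ?b * 0\<^sup>2 / 2) / (2 * pi * ?b)))"
    proof (rule nn_integral_FTC_atLeast)
      show "((\<lambda>z. - exp (- ?b * z\<^sup>2 / 2) / (2 * pi * ?b)) has_real_derivative z * exp (- ?b * z\<^sup>2 / 2) / (2 * pi)) (at z)" for z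
      proof -
        \<comment> \<open>\<open>c\<close> abstracts \<open>a + u\<^sup>2\<close>, of which only
          positivity matters for the derivative.\<close>
        have "((\<lambda>z. - exp (- c * z\<^sup>2 / 2) / (2 * pi * c)) has_real_derivative z * exp (- c * z\<^sup>2 / 2) / (2 * pi)) (at z)"
          if "0 < c" for c :: real
          using that by (auto intro!: derivative_eq_intros)
        from this[OF b] show ?thesis .
      qed
      show "((\<lambda>z. - exp (- ?b * z\<^sup>2 / 2) / (2 * pi * ?b)) \<longlongrightarrow> 0) at_top"
      proof -
        have "((\<lambda>z. - exp (- c * z\<^sup>2 / 2) / (2 * pi * c)) \<longlongrightarrow> 0) at_top" if "0 < c" for c :: real
        proof -
          have "filterlim (\<lambda>z::real. c / 2 * z\<^sup>2) at_top at_top"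
            using that by (intro filterlim_tendsto_pos_mult_at_top[OF tendsto_const] filterlim_pow_at_top filterlim_ident) simp_all
          then have "((\<lambda>z::real. exp (- (c / 2 * z\<^sup>2))) \<longlongrightarrow> 0) at_top"
            by (intro filterlim_compose[OF exp_at_bot] filterlim_compose[OF filterlim_uminus_at_bot_at_top])
          then have "((\<lambda>z::real. - exp (- (c / 2 * z\<^sup>2)) / (2 * pi * c)) \<longlongrightarrow> - 0 / (2 * pi * c)) at_top"
            using that by (intro tendsto_divide tendsto_minus tendsto_const) simp_all
          then show ?thesis by simp
        qed
        from this[OF b] show ?thesis .
      qed
    qed simp_all
    then show "(\<integral>\<^sup>+z. ennreal (z * exp (- ?b * z\<^sup>2 / 2) / (2 * pi)) * indicator {0..} z * indicator {1..} u \<partial>lborel)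
      = ennreal (1 / (2 * pi * ?b)) * indicator {1..} u"
      by (cases "1 \<le> u") (simp_all)
  qed
  also have "\<dots> = ennreal (pi / 2 / (2 * pi * sqrt a) - arctan (1 / sqrt a) / (2 * pi * sqrt a))"
  proof (rule nn_integral_FTC_atLeast)
    show "((\<lambda>u. arctan (u / sqrt a) / (2 * pi * sqrt a)) has_real_derivative 1 / (2 * pi * (a + u\<^sup>2))) (at u)" for u
    proof -
      have "((\<lambda>u. arctan (u / sqrt a) / (2 * pi * sqrt a)) has_real_derivative
        (inverse (1 + (u / sqrt a)\<^sup>2) * (1 / sqrt a)) / (2 * pi * sqrt a)) (at u)"
        using a by (auto intro!: derivative_eq_intros)
      also have "(inverse (1 + (u / sqrt a)\<^sup>2) * (1 / sqrt a)) / (2 * pi * sqrt a) = inverse (1 + u\<^sup>2 / a) / (2 * pi * (sqrt a * sqrt a))"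
        using a by (simp add: power_divide)
      also have "\<dots> = 1 / (2 * pi * (a + u\<^sup>2))"
        using a by (simp add: divide_simps add_nonneg_eq_0_iff)
      finally show ?thesis .
    qed
    show "((\<lambda>u. arctan (u / sqrt a) / (2 * pi * sqrt a)) \<longlongrightarrow> pi / 2 / (2 * pi * sqrt a)) at_top"
    proof -
      have "filterlim (\<lambda>u. 1 / sqrt a * u) at_top at_top"
        using a by (intro filterlim_tendsto_pos_mult_at_top[OF tendsto_const] filterlim_ident) simp_all
      then have "((\<lambda>u. arctan (1 / sqrt a * u)) \<longlongrightarrow> pi / 2) at_top"
        by (rule filterlim_compose[OF tendsto_arctan_at_top])
      then have "((\<lambda>u. arctan (1 / sqrt a * u) / (2 * pi * sqrt a)) \<longlongrightarrow> pi / 2 / (2 * pi * sqrt a)) at_top"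
        using a by (intro tendsto_divide tendsto_const) simp_all
      then show ?thesis by simp
    qed
    show "0 \<le> 1 / (2 * pi * (a + u\<^sup>2))" for u using a by simp
  qed simp
  finally show ?thesis by (simp add: diff_divide_distrib)
qed

text \<open>The square is the probability that two independent standard normal variables both exceed
  \<open>t\<close>. By symmetry this is twice the probability that moreover the second is the larger
  one, and integrating out the larger one gives \<open>gauss_tail z\<close>.\<close>

lemma gauss_tail_square:
  "ennreal ((gauss_tail t)\<^sup>2) =
    (\<integral>\<^sup>+z. ennreal (2 * std_normal_density z * gauss_tail z) * indicator {t..} z \<partial>lborel)"
proof -
  let ?n = "\<lambda>z. ennreal (std_normal_density z)"
  let ?F = "\<lambda>x y. ?n x * ?n y * (indicator {t..} x * indicator {x..} y)"
  \<comment> \<open>The set \<open>{x..}\<close> varies with \<open>x\<close>; written as a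
    comparison, its indicator is visibly measurable in \<open>x\<close> and \<open>y\<close>
    jointly.\<close>
  have ind: "indicator {x..} y = (if x \<le> y then 1 else 0 :: ennreal)" for x y :: real
    by (simp add: indicator_def)
  have m: "case_prod ?F \<in> borel_measurable (lborel \<Otimes>\<^sub>M lborel)"
    "case_prod (\<lambda>x y. ?F y x) \<in> borel_measurable (lborel \<Otimes>\<^sub>M lborel)"
    unfolding ind by measurable
  have half: "(\<integral>\<^sup>+x. (\<integral>\<^sup>+y. ?F x y \<partial>lborel) \<partial>lborel) =
      (\<integral>\<^sup>+z. ennreal (std_normal_density z * gauss_tail z) * indicator {t..} z \<partial>lborel)"
  proof (rule nn_integral_cong)
    fix x
    have "(\<integral>\<^sup>+y. ?F x y \<partial>lborel) = (\<integral>\<^sup>+y. (?n x * indicator {t..} x) * (?n y * indicator {x..} y) \<partial>lborel)"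
      by (intro nn_integral_cong) (simp add: mult_ac)
    also have "\<dots> = ennreal (std_normal_density x * gauss_tail x) * indicator {t..} x"
    proof (subst nn_integral_cmult)
      show "?n x * indicator {t..} x * (\<integral>\<^sup>+y. ?n y * indicator {x..} y \<partial>lborel) =
          ennreal (std_normal_density x * gauss_tail x) * indicator {t..} x"
        by (subst ennreal_gauss_tail[symmetric]) (simp add: ennreal_mult gauss_tail_nonneg mult_ac)
    qed simp
    finally show "(\<integral>\<^sup>+y. ?F x y \<partial>lborel) = ennreal (std_normal_density x * gauss_tail x) * indicator {t..} x" .
  qed
  have "ennreal ((gauss_tail t)\<^sup>2) = ennreal (gauss_tail t) * ennreal (gauss_tail t)"
    by (simp add: power2_eq_square ennreal_mult gauss_tail_nonneg)
  also have "\<dots> = (\<integral>\<^sup>+x. (\<integral>\<^sup>+y. (?n x * indicator {t..} x) * (?n y * indicator {t..} y) \<partial>lborel) \<partial>lborel)"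
    unfolding ennreal_gauss_tail by (simp add: nn_integral_cmult nn_integral_multc)
  also have "\<dots> = (\<integral>\<^sup>+x. (\<integral>\<^sup>+y. ?F x y + ?F y x \<partial>lborel) \<partial>lborel)"
  proof (rule nn_integral_cong, rule nn_integral_cong_AE)
    fix x :: real
    \<comment> \<open>Off the diagonal exactly one of the two orderings holds; on it both summands
      would count.\<close>
    have "AE y in lborel. y \<noteq> x" by (rule AE_lborel_singleton)
    then show "AE y in lborel. (?n x * indicator {t..} x) * (?n y * indicator {t..} y) = ?F x y + ?F y x"
      by eventually_elim (auto simp: indicator_def mult_ac)
  qed
  also have "\<dots> = (\<integral>\<^sup>+x. (\<integral>\<^sup>+y. ?F x y \<partial>lborel) + (\<integral>\<^sup>+y. ?F y x \<partial>lborel) \<partial>lborel)"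
    by (rule nn_integral_cong, rule nn_integral_add) (simp_all add: ind)
  also have "\<dots> = (\<integral>\<^sup>+x. (\<integral>\<^sup>+y. ?F x y \<partial>lborel) \<partial>lborel) + (\<integral>\<^sup>+x. (\<integral>\<^sup>+y. ?F y x \<partial>lborel) \<partial>lborel)"
    by (rule nn_integral_add) (rule lborel.borel_measurable_nn_integral[OF m(1)], rule lborel.borel_measurable_nn_integral[OF m(2)])
  also have "(\<integral>\<^sup>+x. (\<integral>\<^sup>+y. ?F y x \<partial>lborel) \<partial>lborel) = (\<integral>\<^sup>+x. (\<integral>\<^sup>+y. ?F x y \<partial>lborel) \<partial>lborel)"
    by (rule lborel_pair.Fubini'[OF m(1)])
  also note half
  also have "(\<integral>\<^sup>+z. ennreal (std_normal_density z * gauss_tail z) * indicator {t..} z \<partial>lborel) +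
      (\<integral>\<^sup>+z. ennreal (std_normal_density z * gauss_tail z) * indicator {t..} z \<partial>lborel) =
      (\<integral>\<^sup>+z. ennreal (2 * std_normal_density z * gauss_tail z) * indicator {t..} z \<partial>lborel)"
    by (subst nn_integral_add[symmetric])
       (auto intro!: nn_integral_cong simp: distrib_right[symmetric] ennreal_plus[symmetric] gauss_tail_nonneg simp del: ennreal_plus)
  finally show ?thesis .
qed

text \<open>At \<open>t = 0\<close> the square is twice the arctangent integral with
  \<open>a = 1\<close>, that is \<open>2 * (pi / 2 - pi / 4) / (2 * pi) = 1 / 4\<close>;
  nonnegativity selects the root.\<close>

lemma gauss_tail_0: "gauss_tail 0 = 1 / 2"
proof -
  have "ennreal ((gauss_tail 0)\<^sup>2) =
      (\<integral>\<^sup>+z. 2 * (ennreal (exp (- 1 * z\<^sup>2 / 2) / sqrt (2 * pi) * gauss_tail z) * indicator {0..} z) \<partial>lborel)"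
    unfolding gauss_tail_square
    by (intro nn_integral_cong)
       (simp add: std_normal_density_def mult.assoc[symmetric] ennreal_mult'[symmetric] flip: ennreal_numeral)
  also have "\<dots> = 2 * ennreal ((pi / 2 - arctan (1 / sqrt 1)) / (2 * pi * sqrt 1))"
    by (subst nn_integral_cmult) (simp_all add: nn_integral_exp_gauss_tail[of 1, simplified])
  also have "\<dots> = ennreal ((1 / 2)\<^sup>2)"
    by (simp add: arctan_one power2_eq_square ennreal_mult'[symmetric] flip: ennreal_numeral)
  finally have "(gauss_tail 0)\<^sup>2 = (1 / 2)\<^sup>2" by (subst (asm) ennreal_inj) simp_all
  then show ?thesis by (simp only: power2_eq_iff_nonneg gauss_tail_nonneg)
qed

text \<open>For exponentially distributed $x$, the order of integration is exchanged:
  $c \sqrt x \le z$ means $x \le (z/c)^2$.\<close>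

lemma nn_integral_exponential_tail:
  fixes \<psi> G :: "real \<Rightarrow> real"
  assumes [measurable]: "\<psi> \<in> borel_measurable borel" and nonneg: "\<And>z. 0 \<le> \<psi> z" and c: "0 < c"
    and A: "(\<integral>\<^sup>+z. ennreal (\<psi> z) * indicator {0..} z \<partial>lborel) = ennreal A"
    and B: "(\<integral>\<^sup>+z. ennreal (\<psi> z * exp (- (z / c)\<^sup>2)) * indicator {0..} z \<partial>lborel) = ennreal B" and "0 \<le> A" "0 \<le> B"
    and G: "\<And>t. ennreal (G t) = (\<integral>\<^sup>+z. ennreal (\<psi> z) * indicator {t..} z \<partial>lborel)"
  shows "(\<integral>\<^sup>+x. ennreal (exp (- x)) * indicator {0..} x * ennreal (G (c * sqrt x)) \<partial>lborel) = ennreal (A - B)"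
    and "B \<le> A"
proof -
  have mono: "ennreal (\<psi> z * exp (- (z / c)\<^sup>2)) * indicator {0..} z \<le> ennreal (\<psi> z) * indicator {0..} z" for z
    using nonneg by (auto simp: indicator_def mult_left_le intro: ennreal_leI)
  then have "ennreal B \<le> ennreal A"
    unfolding A[symmetric] B[symmetric] by (intro nn_integral_mono)
  then show "B \<le> A" using \<open>0 \<le> A\<close> by simp
  \<comment> \<open>For fixed \<open>z \<ge> 0\<close> the admissible \<open>x\<close> fill
    \<open>{0..(z / c)\<^sup>2}\<close>, of exponential mass
    \<open>1 - exp (- (z / c)\<^sup>2)\<close>. For \<open>z < 0\<close> there are none, since
    \<open>c * sqrt x \<ge> 0\<close>.\<close>
  have inner: "(\<integral>\<^sup>+x. ennreal (exp (- x)) * indicator {0..} x * (ennreal (\<psi> z) * indicator {c * sqrt x..} z) \<partial>lborel) =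
      ennreal (\<psi> z) * indicator {0..} z - ennreal (\<psi> z * exp (- (z / c)\<^sup>2)) * indicator {0..} z" for z
  proof (cases "0 \<le> z")
    case True
    have iff: "c * sqrt x \<le> z \<longleftrightarrow> x \<le> (z / c)\<^sup>2" if "0 \<le> x" for x
    proof -
      have "c * sqrt x \<le> z \<longleftrightarrow> sqrt x \<le> z / c" using c by (simp add: field_simps)
      also have "\<dots> \<longleftrightarrow> x \<le> (z / c)\<^sup>2"
        using True c that by (metis divide_nonneg_pos real_le_lsqrt sqrt_le_D)
      finally show ?thesis .
    qed
    have "(\<integral>\<^sup>+x. ennreal (exp (- x)) * indicator {0..} x * (ennreal (\<psi> z) * indicator {c * sqrt x..} z) \<partial>lborel) =
      (\<integral>\<^sup>+x. ennreal (\<psi> z) * (ennreal (exp (- x)) * indicator {0..(z / c)\<^sup>2} x) \<partial>lborel)"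
      by (intro nn_integral_cong) (auto simp: indicator_def iff mult_ac)
    also have "\<dots> = ennreal (\<psi> z) * ennreal (- exp (- (z / c)\<^sup>2) - - exp (- 0))"
    proof (subst nn_integral_cmult, simp, intro arg_cong2[where f="(*)"] refl nn_integral_FTC_Icc)
      show "((\<lambda>x. - exp (- x)) has_real_derivative exp (- x)) (at x)" for x :: real
        by (auto intro!: derivative_eq_intros)
    qed simp_all
    also have "\<dots> = ennreal (\<psi> z) - ennreal (\<psi> z * exp (- (z / c)\<^sup>2))"
      using nonneg by (simp add: ennreal_mult[symmetric] ennreal_minus right_diff_distrib)
    finally show ?thesis using True by simp
  next
    case False
    have "(\<integral>\<^sup>+x. ennreal (exp (- x)) * indicator {0..} x * (ennreal (\<psi> z) * indicator {c * sqrt x..} z) \<partial>lborel) = (\<integral>\<^sup>+(x::real). 0 \<partial>lborel)"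
    proof (intro nn_integral_cong)
      fix x
      have "0 \<le> c * sqrt x" if "0 \<le> x" using c that by simp
      then show "ennreal (exp (- x)) * indicator {0..} x * (ennreal (\<psi> z) * indicator {c * sqrt x..} z) = 0"
        using False by (auto simp: indicator_def)
    qed
    then show ?thesis using False by simp
  qed
  have "(\<integral>\<^sup>+x. ennreal (exp (- x)) * indicator {0..} x * ennreal (G (c * sqrt x)) \<partial>lborel) =
    (\<integral>\<^sup>+x. (\<integral>\<^sup>+z. ennreal (exp (- x)) * indicator {0..} x * (ennreal (\<psi> z) * indicator {c * sqrt x..} z) \<partial>lborel) \<partial>lborel)"
    unfolding G by (intro nn_integral_cong nn_integral_cmult[symmetric]) simp
  also have "\<dots> = (\<integral>\<^sup>+z. (\<integral>\<^sup>+x. ennreal (exp (- x)) * indicator {0..} x * (ennreal (\<psi> z) * indicator {c * sqrt x..} z) \<partial>lborel) \<partial>lborel)"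
  proof (rule lborel_pair.Fubini')
    have ind: "indicator {c * sqrt x..} z = (if c * sqrt x \<le> z then 1 else 0 :: ennreal)" for x z
      by (simp add: indicator_def)
    show "(\<lambda>(z, x). ennreal (exp (- x)) * indicator {0..} x * (ennreal (\<psi> z) * indicator {c * sqrt x..} z))
        \<in> borel_measurable (lborel \<Otimes>\<^sub>M lborel)"
      unfolding ind by measurable
  qed
  also have "\<dots> = (\<integral>\<^sup>+z. ennreal (\<psi> z) * indicator {0..} z \<partial>lborel) -
      (\<integral>\<^sup>+z. ennreal (\<psi> z * exp (- (z / c)\<^sup>2)) * indicator {0..} z \<partial>lborel)"
    unfolding inner
  proof (rule nn_integral_diff)
    show "AE z in lborel. ennreal (\<psi> z * exp (- (z / c)\<^sup>2)) * indicator {0..} z \<le> ennreal (\<psi> z) * indicator {0..} z"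
      by (simp add: mono)
  qed (simp_all add: B)
  finally show "(\<integral>\<^sup>+x. ennreal (exp (- x)) * indicator {0..} x * ennreal (G (c * sqrt x)) \<partial>lborel) = ennreal (A - B)"
    using \<open>0 \<le> B\<close> by (simp add: A B ennreal_minus)
qed

text \<open>The damped standard normal density is \<open>1 / b\<close> times the centred normal
  density of standard deviation \<open>1 / b\<close>. Half of its mass lies on the nonnegative
  half-line, so \<open>A = 1 / 2\<close> is diminished by \<open>B = 1 / (2 * b)\<close>.\<close>

lemma nn_integral_exponential_gauss_tail:
  assumes c: "0 < c" and b: "b = sqrt (1 + 2 / c\<^sup>2)"
  shows "(\<integral>\<^sup>+x. ennreal (exp (- x)) * indicator {0..} x * ennreal (gauss_tail (c * sqrt x)) \<partial>lborel)
    = ennreal (1 / 2 * (1 - 1 / b))"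
proof -
  have b0: "0 < b" using b by (simp add: add_pos_nonneg)
  have b2: "b\<^sup>2 = 1 + 2 / c\<^sup>2" using b by (simp add: add_nonneg_nonneg)
  have "(\<integral>\<^sup>+z. ennreal (std_normal_density z * exp (- (z / c)\<^sup>2)) * indicator {0..} z \<partial>lborel) =
    (\<integral>\<^sup>+z. ennreal (1 / b) * (ennreal (normal_density 0 (1 / b) z) * indicator {0..} z) \<partial>lborel)"
  proof (intro nn_integral_cong)
    fix z
    have "std_normal_density z * exp (- (z / c)\<^sup>2) = (1 / b) * normal_density 0 (1 / b) z"
    proof -
      have "exp (- z\<^sup>2 / 2) * exp (- (z / c)\<^sup>2) = exp (- (z\<^sup>2 * b\<^sup>2) / 2)"
        unfolding exp_add[symmetric] b2 by (simp add: field_simps power_divide)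
      then show ?thesis
        using b0 by (simp add: normal_density_def real_sqrt_mult real_sqrt_divide power_divide)
    qed
    then show "ennreal (std_normal_density z * exp (- (z / c)\<^sup>2)) * indicator {0..} z =
        ennreal (1 / b) * (ennreal (normal_density 0 (1 / b) z) * indicator {0..} z)"
      using b0 by (simp add: ennreal_mult[symmetric] mult.assoc[symmetric])
  qed
  also have "\<dots> = ennreal (1 / b * (1 / 2))"
    using b0 by (subst nn_integral_cmult) (simp_all add: nn_integral_normal_atLeast gauss_tail_0 ennreal_mult[symmetric] del: ennreal_half)
  finally have B: "(\<integral>\<^sup>+z. ennreal (std_normal_density z * exp (- (z / c)\<^sup>2)) * indicator {0..} z \<partial>lborel) = ennreal (1 / b * (1 / 2))" .
  have "(\<integral>\<^sup>+x. ennreal (exp (- x)) * indicator {0..} x * ennreal (gauss_tail (c * sqrt x)) \<partial>lborel) = ennreal (1 / 2 - 1 / b * (1 / 2))"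
    by (rule nn_integral_exponential_tail(1)[OF _ _ c _ B])
       (use b0 in \<open>simp_all only: ennreal_gauss_tail[symmetric] gauss_tail_0, simp_all\<close>)
  also have "1 / 2 - 1 / b * (1 / 2) = 1 / 2 * (1 - 1 / b)" by (simp add: algebra_simps)
  finally show ?thesis .
qed

text \<open>By \<open>gauss_tail_square\<close> the integrand is
  \<open>2 * std_normal_density z * gauss_tail z\<close>, so \<open>A\<close> is the squared tail at
  0, \<open>1 / 4\<close>, and \<open>B\<close> is twice the arctangent integral with
  \<open>a = b\<^sup>2\<close>. The sign of the closed form is not apparent from the formula; it
  comes from \<open>B \<le> A\<close> and is needed to pass from \<open>ennreal\<close> to real
  expectations.\<close>

lemma nn_integral_exponential_gauss_tail_square:
  assumes c: "0 < c" and b: "b = sqrt (1 + 2 / c\<^sup>2)"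
  shows "(\<integral>\<^sup>+x. ennreal (exp (- x)) * indicator {0..} x * ennreal ((gauss_tail (c * sqrt x))\<^sup>2) \<partial>lborel)
    = ennreal (1 / 2 * (2 / pi * (1 / b) * arctan (1 / b) - 1 / b + 1 / 2))"
    and "0 \<le> 1 / 2 * (2 / pi * (1 / b) * arctan (1 / b) - 1 / b + 1 / 2)"
proof -
  have b0: "0 < b" using b by (simp add: add_pos_nonneg)
  have b2: "b\<^sup>2 = 1 + 2 / c\<^sup>2" using b by (simp add: add_nonneg_nonneg)
  let ?B = "2 * ((pi / 2 - arctan (1 / b)) / (2 * pi * b))"
  have B0: "0 \<le> ?B" using b0 arctan_ubound[of "1 / b"] by simp
  have "(\<integral>\<^sup>+z. ennreal (2 * std_normal_density z * gauss_tail z * exp (- (z / c)\<^sup>2)) * indicator {0..} z \<partial>lborel) =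
    (\<integral>\<^sup>+z. 2 * (ennreal (exp (- b\<^sup>2 * z\<^sup>2 / 2) / sqrt (2 * pi) * gauss_tail z) * indicator {0..} z) \<partial>lborel)"
  proof (intro nn_integral_cong)
    fix z
    have "exp (- z\<^sup>2 / 2) * exp (- (z / c)\<^sup>2) = exp (- b\<^sup>2 * z\<^sup>2 / 2)"
      unfolding exp_add[symmetric] b2 by (simp add: field_simps power_divide)
    then have "2 * std_normal_density z * gauss_tail z * exp (- (z / c)\<^sup>2) = 2 * (exp (- b\<^sup>2 * z\<^sup>2 / 2) / sqrt (2 * pi) * gauss_tail z)"
      by (simp add: std_normal_density_def mult_ac)
    then show "ennreal (2 * std_normal_density z * gauss_tail z * exp (- (z / c)\<^sup>2)) * indicator {0..} z =
        2 * (ennreal (exp (- b\<^sup>2 * z\<^sup>2 / 2) / sqrt (2 * pi) * gauss_tail z) * indicator {0..} z)"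
      by (simp only: ennreal_mult'[symmetric] mult.assoc[symmetric] flip: ennreal_numeral)
  qed
  also have "\<dots> = ennreal ?B"
    using nn_integral_exp_gauss_tail[of "b\<^sup>2"] b0
    by (subst nn_integral_cmult) (simp_all add: ennreal_mult'[symmetric] flip: ennreal_numeral)
  finally have B: "(\<integral>\<^sup>+z. ennreal (2 * std_normal_density z * gauss_tail z * exp (- (z / c)\<^sup>2)) * indicator {0..} z \<partial>lborel) = ennreal ?B" .
  have eq: "1 / 4 - ?B = 1 / 2 * (2 / pi * (1 / b) * arctan (1 / b) - 1 / b + 1 / 2)"
    using b0 by (simp add: field_simps)
  have "(\<integral>\<^sup>+x. ennreal (exp (- x)) * indicator {0..} x * ennreal ((gauss_tail (c * sqrt x))\<^sup>2) \<partial>lborel) = ennreal (1 / 4 - ?B)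
      \<and> ?B \<le> 1 / 4"
  proof
    note tail = nn_integral_exponential_tail[OF _ _ c _ B _ B0]
    show "(\<integral>\<^sup>+x. ennreal (exp (- x)) * indicator {0..} x * ennreal ((gauss_tail (c * sqrt x))\<^sup>2) \<partial>lborel) = ennreal (1 / 4 - ?B)"
      by (rule tail(1))
         (simp_all add: gauss_tail_nonneg gauss_tail_square[symmetric] gauss_tail_0 power2_eq_square)
    show "?B \<le> 1 / 4"
      by (rule tail(2)[where G = "\<lambda>t. (gauss_tail t)\<^sup>2"])
         (simp_all add: gauss_tail_nonneg gauss_tail_square[symmetric] gauss_tail_0 power2_eq_square)
  qed
  then show "(\<integral>\<^sup>+x. ennreal (exp (- x)) * indicator {0..} x * ennreal ((gauss_tail (c * sqrt x))\<^sup>2) \<partial>lborel)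
      = ennreal (1 / 2 * (2 / pi * (1 / b) * arctan (1 / b) - 1 / b + 1 / 2))"
    and "0 \<le> 1 / 2 * (2 / pi * (1 / b) * arctan (1 / b) - 1 / b + 1 / 2)"
    unfolding eq[symmetric] by simp_all
qed

section \<open>Circularly symmetric complex Gaussians\<close>

lemma measurable_Complex_pair [measurable]: "(\<lambda>(x, y). Complex x y) \<in> borel_measurable (borel \<Otimes>\<^sub>M borel)"
  by (simp add: borel_measurable_complex_iff case_prod_beta)

text \<open>Lebesgue measure is determined by its values on boxes. The basis of the complex numbers
  is \<open>1\<close> and \<open>\<i>\<close>, so a box is a product of two open intervals.\<close>

lemma lborel_complex: "(lborel :: complex measure) = distr (lborel \<Otimes>\<^sub>M lborel) borel (\<lambda>(x, y). Complex x y)"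
proof (rule lborel_eqI)
  fix l u :: complex assume le: "\<And>b. b \<in> Basis \<Longrightarrow> l \<bullet> b \<le> u \<bullet> b"
  have lu: "Re l \<le> Re u" "Im l \<le> Im u" using le[of 1] le[of \<i>] by (simp_all add: Basis_complex_def inner_complex_def)
  have "(\<lambda>(x, y). Complex x y) -` box l u \<inter> space (lborel \<Otimes>\<^sub>M lborel) = {Re l<..<Re u} \<times> {Im l<..<Im u}"
    by (auto simp: space_pair_measure box_def Basis_complex_def inner_complex_def)
  then show "emeasure (distr (lborel \<Otimes>\<^sub>M lborel) borel (\<lambda>(x, y). Complex x y)) (box l u) = ennreal (\<Prod>b\<in>Basis. (u - l) \<bullet> b)"
    using lu by (simp add: emeasure_distr lborel.emeasure_pair_measure_Times Basis_complex_def inner_complex_def ennreal_mult)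
qed simp

lemma nn_integral_complex:
  fixes f :: "complex \<Rightarrow> ennreal"
  assumes [measurable]: "f \<in> borel_measurable borel"
  shows "(\<integral>\<^sup>+z. f z \<partial>lborel) = (\<integral>\<^sup>+x. (\<integral>\<^sup>+y. f (Complex x y) \<partial>lborel) \<partial>lborel)"
  by (simp add: lborel_complex nn_integral_distr lborel.nn_integral_fst[symmetric] case_prod_beta)

lemma measurable_comp_Complex [measurable (raw)]:
  "f \<in> borel_measurable M \<Longrightarrow> g \<in> borel_measurable M \<Longrightarrow> (\<lambda>x. Complex (f x) (g x)) \<in> borel_measurable M"
  by (simp add: borel_measurable_complex_iff)

text \<open>Multiplication by \<open>g = a + b * \<i>\<close> is linear with determinant
  \<open>a\<^sup>2 + b\<^sup>2\<close>. It is carried out one real coordinate at a time, so that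
  only affine substitutions on the line and Tonelli's theorem enter.\<close>

lemma nn_integral_complex_mult:
  fixes f :: "complex \<Rightarrow> ennreal"
  assumes [measurable]: "f \<in> borel_measurable borel" and g: "g \<noteq> 0"
  shows "(\<integral>\<^sup>+z. f z \<partial>lborel) = ennreal ((cmod g)\<^sup>2) * (\<integral>\<^sup>+z. f (g * z) \<partial>lborel)"
proof (cases g)
  case (Complex a b)
  have norm: "(cmod g)\<^sup>2 = a\<^sup>2 + b\<^sup>2" unfolding Complex cmod_power2 by simp
  have mult: "g * Complex x y = Complex (a * x - b * y) (b * x + a * y)" for x y
    unfolding Complex by (simp add: complex_eq_iff)
  show ?thesis
  proof (cases "b = 0")
    case True
    then have a: "a \<noteq> 0" using g Complex by (auto simp: complex_eq_iff)
    have "(\<integral>\<^sup>+z. f z \<partial>lborel) = \<bar>a\<bar> * (\<integral>\<^sup>+x. (\<integral>\<^sup>+y. f (Complex (0 + a * x) y) \<partial>lborel) \<partial>lborel)"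
      unfolding nn_integral_complex[OF assms(1)] by (rule nn_integral_real_affine[OF _ a]) simp
    also have "\<dots> = \<bar>a\<bar> * (\<integral>\<^sup>+x. \<bar>a\<bar> * (\<integral>\<^sup>+y. f (Complex (0 + a * x) (0 + a * y)) \<partial>lborel) \<partial>lborel)"
      by (intro arg_cong2[where f="(*)"] nn_integral_cong nn_integral_real_affine refl a) simp
    also have "\<dots> = ennreal \<bar>a\<bar> * ennreal \<bar>a\<bar> * (\<integral>\<^sup>+x. (\<integral>\<^sup>+y. f (g * Complex x y) \<partial>lborel) \<partial>lborel)"
      unfolding mult using True by (subst nn_integral_cmult) (simp_all add: mult.assoc)
    also have "\<dots> = ennreal ((cmod g)\<^sup>2) * (\<integral>\<^sup>+z. f (g * z) \<partial>lborel)"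
      unfolding norm using True by (simp add: nn_integral_complex ennreal_mult[symmetric] power2_eq_square)
    finally show ?thesis .
  next
    case b: False
    let ?n = "a\<^sup>2 + b\<^sup>2"
    have n: "0 < ?n" using b by (simp add: add_nonneg_pos)
    have c: "- ?n / b \<noteq> 0" using b n by simp
    have "(\<integral>\<^sup>+z. f z \<partial>lborel) = (\<integral>\<^sup>+s. (\<integral>\<^sup>+r. f (Complex r s) \<partial>lborel) \<partial>lborel)"
      unfolding nn_integral_complex[OF assms(1)] by (rule lborel_pair.Fubini') simp
    \<comment> \<open>Eliminating \<open>x\<close> from \<open>r = a * x - b * y\<close> and
      \<open>s = b * x + a * y\<close> gives \<open>r = a * s / b - ?n / b * y\<close>. So
      \<open>y\<close> replaces \<open>r\<close> at fixed \<open>s\<close>, and then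
      \<open>x\<close> replaces \<open>s\<close> at fixed \<open>y\<close>; the Jacobians multiply
      to \<open>?n\<close>. Division by \<open>b\<close> is why real \<open>g\<close> is a separate
      case.\<close>
    also have "\<dots> = (\<integral>\<^sup>+s. ennreal \<bar>- ?n / b\<bar> * (\<integral>\<^sup>+y. f (Complex (a * s / b + - ?n / b * y) s) \<partial>lborel) \<partial>lborel)"
      by (intro nn_integral_cong nn_integral_real_affine c) simp
    also have "\<dots> = ennreal \<bar>- ?n / b\<bar> * (\<integral>\<^sup>+s. (\<integral>\<^sup>+y. f (Complex (a * s / b + - ?n / b * y) s) \<partial>lborel) \<partial>lborel)"
      by (rule nn_integral_cmult) simp
    also have "(\<integral>\<^sup>+s. (\<integral>\<^sup>+y. f (Complex (a * s / b + - ?n / b * y) s) \<partial>lborel) \<partial>lborel) =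
        (\<integral>\<^sup>+y. (\<integral>\<^sup>+s. f (Complex (a * s / b + - ?n / b * y) s) \<partial>lborel) \<partial>lborel)"
      by (rule lborel_pair.Fubini') simp
    also have "\<dots> = (\<integral>\<^sup>+y. ennreal \<bar>b\<bar> * (\<integral>\<^sup>+x. f (Complex (a * (a * y + b * x) / b + - ?n / b * y) (a * y + b * x)) \<partial>lborel) \<partial>lborel)"
      by (intro nn_integral_cong nn_integral_real_affine b) simp
    also have "\<dots> = ennreal \<bar>b\<bar> * (\<integral>\<^sup>+y. (\<integral>\<^sup>+x. f (Complex (a * (a * y + b * x) / b + - ?n / b * y) (a * y + b * x)) \<partial>lborel) \<partial>lborel)"
      by (rule nn_integral_cmult) simp
    also have "(\<lambda>y x. f (Complex (a * (a * y + b * x) / b + - ?n / b * y) (a * y + b * x))) = (\<lambda>y x. f (g * Complex x y))"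
    proof (intro ext arg_cong[where f=f])
      fix x y show "Complex (a * (a * y + b * x) / b + - ?n / b * y) (a * y + b * x) = g * Complex x y"
        unfolding mult using b by (simp add: complex_eq_iff field_simps power2_eq_square)
    qed
    also have "(\<integral>\<^sup>+y. (\<integral>\<^sup>+x. f (g * Complex x y) \<partial>lborel) \<partial>lborel) = (\<integral>\<^sup>+x. (\<integral>\<^sup>+y. f (g * Complex x y) \<partial>lborel) \<partial>lborel)"
      by (rule lborel_pair.Fubini') simp
    also have "\<dots> = (\<integral>\<^sup>+z. f (g * z) \<partial>lborel)" by (simp add: nn_integral_complex)
    also have "ennreal \<bar>- ?n / b\<bar> * (ennreal \<bar>b\<bar> * (\<integral>\<^sup>+z. f (g * z) \<partial>lborel)) = ennreal ((cmod g)\<^sup>2) * (\<integral>\<^sup>+z. f (g * z) \<partial>lborel)"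
      using b n by (simp add: norm mult.assoc[symmetric] ennreal_mult[symmetric] abs_divide add.commute)
    finally show ?thesis .
  qed
qed

section \<open>Circular Gaussian densities: factorization, scaling and convolution\<close>

lemma borel_measurable_cgauss_density [measurable]: "cgauss_density v \<in> borel_measurable borel"
  unfolding cgauss_density_def by measurable

lemma cgauss_density_pos: "0 < v \<Longrightarrow> 0 < cgauss_density v z"
  by (simp add: cgauss_density_def)

lemma cgauss_density_Complex:
  assumes "0 < v"
  shows "cgauss_density v (Complex x y) = normal_density 0 (sqrt v) x * normal_density 0 (sqrt v) y"
proof -
  have "exp (- (x\<^sup>2 + y\<^sup>2) / (2 * v)) = exp (- x\<^sup>2 / (2 * v)) * exp (- y\<^sup>2 / (2 * v))"
    unfolding exp_add[symmetric] by (simp add: diff_divide_distrib)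
  then show ?thesis
    using assms by (simp add: cgauss_density_def normal_density_def cmod_power2)
qed

text \<open>The Jacobian is exactly the change of the normalizing constant. Only the modulus of
  \<open>g\<close> enters, which is why the law of \<open>|h|^2\<close> determines the error
  probability whatever the phase of \<open>h\<close>.\<close>

lemma cgauss_density_mult:
  assumes "g \<noteq> 0" "0 < v"
  shows "(cmod g)\<^sup>2 * cgauss_density v (g * u) = cgauss_density (v / (cmod g)\<^sup>2) u"
  using assms by (simp add: cgauss_density_def norm_mult power_mult_distrib field_simps)

lemma nn_integral_cgauss_rect:
  assumes v: "0 < v" and [measurable]: "I \<in> sets borel" "J \<in> sets borel"
  shows "(\<integral>\<^sup>+u. ennreal (cgauss_density v u) * (indicator I (Re u) * indicator J (Im u)) \<partial>lborel) =
    (\<integral>\<^sup>+x. ennreal (normal_density 0 (sqrt v) x) * indicator I x \<partial>lborel) *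
    (\<integral>\<^sup>+y. ennreal (normal_density 0 (sqrt v) y) * indicator J y \<partial>lborel)"
proof -
  let ?n = "\<lambda>x. ennreal (normal_density 0 (sqrt v) x)"
  have "(\<integral>\<^sup>+u. ennreal (cgauss_density v u) * (indicator I (Re u) * indicator J (Im u)) \<partial>lborel) =
    (\<integral>\<^sup>+x. (\<integral>\<^sup>+y. (?n x * indicator I x) * (?n y * indicator J y) \<partial>lborel) \<partial>lborel)"
    using v by (subst nn_integral_complex) (auto intro!: nn_integral_cong simp: cgauss_density_Complex ennreal_mult mult_ac)
  also have "\<dots> = (\<integral>\<^sup>+x. (?n x * indicator I x) * (\<integral>\<^sup>+y. ?n y * indicator J y \<partial>lborel) \<partial>lborel)"
    by (intro nn_integral_cong nn_integral_cmult) simp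
  also have "\<dots> = (\<integral>\<^sup>+x. ?n x * indicator I x \<partial>lborel) * (\<integral>\<^sup>+y. ?n y * indicator J y \<partial>lborel)"
    by (rule nn_integral_multc) simp
  finally show ?thesis .
qed

text \<open>Both densities factor over real and imaginary part, so the convolution splits into two
  on the line, where variances of centred normal densities add.\<close>

lemma cgauss_density_convolution:
  assumes "0 < a" "0 < b"
  shows "(\<integral>\<^sup>+w. ennreal (cgauss_density a (z - w)) * ennreal (cgauss_density b w) \<partial>lborel) = ennreal (cgauss_density (a + b) z)"
proof (cases z)
  case (Complex x y)
  let ?a = "normal_density 0 (sqrt a)" and ?b = "normal_density 0 (sqrt b)"
  have conv: "(\<integral>\<^sup>+t. ennreal (?a (x - t) * ?b t) \<partial>lborel) = ennreal (normal_density 0 (sqrt (a + b)) x)" for x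
    using fun_cong[OF conv_normal_density_zero_mean[of "sqrt a" "sqrt b"], of x] assms by simp
  have "(\<integral>\<^sup>+w. ennreal (cgauss_density a (z - w)) * ennreal (cgauss_density b w) \<partial>lborel) =
    (\<integral>\<^sup>+s. (\<integral>\<^sup>+t. ennreal (?a (x - s) * ?b s) * ennreal (?a (y - t) * ?b t) \<partial>lborel) \<partial>lborel)"
    using assms
    by (subst nn_integral_complex)
       (auto intro!: nn_integral_cong simp: Complex complex_diff cgauss_density_Complex ennreal_mult[symmetric] mult_ac)
  also have "\<dots> = ennreal (normal_density 0 (sqrt (a + b)) x) * ennreal (normal_density 0 (sqrt (a + b)) y)"
    by (simp add: nn_integral_cmult nn_integral_multc conv)
  also have "\<dots> = ennreal (cgauss_density (a + b) z)"
    using assms by (simp add: Complex cgauss_density_Complex ennreal_mult)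
  finally show ?thesis .
qed

section \<open>Decision intervals of a row of equidistant points\<close>

definition open_cell :: "nat \<Rightarrow> real \<Rightarrow> nat \<Rightarrow> real set" where
  "open_cell m a n = {x. (0 < n \<longrightarrow> - a < x) \<and> (Suc n < m \<longrightarrow> x < a)}"

text \<open>A side is bounded only if there is a neighbour on it, so the outermost intervals are
  half-lines and for \<open>m = 1\<close> the interval is the whole line. In the open variant the
  point is the unique nearest one, and outside the closed variant it is not nearest; ties lie in
  between.\<close>

definition closed_cell :: "nat \<Rightarrow> real \<Rightarrow> nat \<Rightarrow> real set" where
  "closed_cell m a n = {x. (0 < n \<longrightarrow> - a \<le> x) \<and> (Suc n < m \<longrightarrow> x \<le> a)}"

text \<open>\<open>T\<close> is the Gaussian tail beyond distance \<open>a\<close>: the decision interval of the \<open>n\<close>-th of \<open>m\<close>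
  equidistant points with spacing \<open>2 * a\<close>, relative to that point, misses one tail for each neighbour.\<close>

definition cell_prob :: "nat \<Rightarrow> nat \<Rightarrow> real \<Rightarrow> real" where
  "cell_prob m n T = 1 - (of_bool (0 < n) + of_bool (Suc n < m)) * T"

lemma cell_measurable [measurable]: "open_cell m a n \<in> sets borel" "closed_cell m a n \<in> sets borel"
  unfolding open_cell_def closed_cell_def by measurable

lemma open_cell_subset_closed_cell: "open_cell m a n \<subseteq> closed_cell m a n"
  by (auto simp: open_cell_def closed_cell_def)

text \<open>The total mass 1 is split into \<open>I\<close> and one tail for each neighbour. Any
  \<open>I\<close> between the two variants gives the same partition away from the endpoints
  \<open>a\<close> and \<open>- a\<close>, which carry no mass.\<close>

lemma nn_integral_normal_cell:
  assumes t: "0 < t" and a: "0 < a" and [measurable]: "I \<in> sets borel"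
    and lower: "open_cell m a n \<subseteq> I" and upper: "I \<subseteq> closed_cell m a n"
  shows "(\<integral>\<^sup>+x. ennreal (normal_density 0 t x) * indicator I x \<partial>lborel) =
    ennreal (cell_prob m n (gauss_tail (a / t)))" (is "?S = _")
proof -
  let ?N = "\<lambda>x. ennreal (normal_density 0 t x)"
  let ?k = "of_bool (0 < n) + of_bool (Suc n < m) :: real"
  have left: "(\<integral>\<^sup>+x. ?N x * indicator {..- a} x \<partial>lborel) = gauss_tail (a / t)"
  proof -
    have "(\<integral>\<^sup>+x. ?N x * indicator {..- a} x \<partial>lborel) = (\<integral>\<^sup>+x. ?N (0 + -1 * x) * indicator {..- a} (0 + -1 * x) \<partial>lborel)"
      by (subst nn_integral_real_affine[where c="-1" and t=0]) simp_all
    also have "\<dots> = (\<integral>\<^sup>+x. ?N x * indicator {a..} x \<partial>lborel)"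
      by (intro nn_integral_cong) (auto simp: normal_density_def indicator_def)
    finally show ?thesis by (simp add: nn_integral_normal_atLeast[OF t])
  qed
  have "1 = (\<integral>\<^sup>+x. ?N x \<partial>lborel)" by (simp add: nn_integral_normal_density[OF t])
  also have "\<dots> = (\<integral>\<^sup>+x. ?N x * indicator I x +
      (of_bool (0 < n) * (?N x * indicator {..- a} x) + of_bool (Suc n < m) * (?N x * indicator {a..} x)) \<partial>lborel)"
  proof (rule nn_integral_cong_AE)
    have "AE x in lborel. x \<noteq> a" "AE x in lborel. x \<noteq> - a" by (rule AE_lborel_singleton)+
    then show "AE x in lborel. ?N x = ?N x * indicator I x +
      (of_bool (0 < n) * (?N x * indicator {..- a} x) + of_bool (Suc n < m) * (?N x * indicator {a..} x))"
    proof eventually_elim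
      case (elim x)
      have "x \<in> I \<longleftrightarrow> \<not> (0 < n \<and> x \<le> - a) \<and> \<not> (Suc n < m \<and> a \<le> x)"
        using subsetD[OF lower, of x] subsetD[OF upper, of x] elim by (auto simp: open_cell_def closed_cell_def)
      \<comment> \<open>The two tails must not overlap; here positivity of \<open>a\<close>
        enters.\<close>
      moreover have "\<not> (x \<le> - a \<and> a \<le> x)" using a by simp
      ultimately show ?case by (auto simp: indicator_def)
    qed
  qed
  also have "\<dots> = ?S + (of_bool (0 < n) * ennreal (gauss_tail (a / t)) + of_bool (Suc n < m) * ennreal (gauss_tail (a / t)))"
    by (simp add: nn_integral_add nn_integral_cmult left nn_integral_normal_atLeast[OF t])
  also have "of_bool (0 < n) * ennreal (gauss_tail (a / t)) + of_bool (Suc n < m) * ennreal (gauss_tail (a / t)) =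
      ennreal (?k * gauss_tail (a / t))"
    by (auto simp: of_bool_def ennreal_plus[symmetric] gauss_tail_nonneg simp del: ennreal_plus)
  finally have sum: "1 = ?S + ennreal (?k * gauss_tail (a / t))" .
  then have "?S = 1 - ennreal (?k * gauss_tail (a / t))"
    by (metis ennreal_add_diff_cancel_right ennreal_neq_top infinity_ennreal_def)
  then show ?thesis
    by (simp add: cell_prob_def ennreal_minus[symmetric] gauss_tail_nonneg)
qed

text \<open>Each of the \<open>m - 1\<close> gaps between neighbours costs one tail on either side,
  hence the coefficient \<open>2 * (m - 1)\<close>.\<close>

lemma sum_cell_prob:
  assumes "1 \<le> m"
  shows "(\<Sum>n<m. cell_prob m n T) = real m - 2 * (real m - 1) * T"
proof -
  obtain j where m: "m = Suc j" using assms by (cases m) auto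
  have "(\<Sum>n<m. of_bool (0 < n) :: real) = real m - 1"
    unfolding m by (subst sum.lessThan_Suc_shift) simp
  moreover have "(\<Sum>n<m. of_bool (Suc n < m) :: real) = real m - 1"
    unfolding m by simp
  ultimately show ?thesis
    by (simp add: cell_prob_def sum_subtractf sum_distrib_right[symmetric] sum.distrib)
qed

text \<open>Since the density is rotation invariant, dividing by the fading coefficient \<open>g\<close> turns the
  decision region into an axis-parallel rectangle and divides the variance by $|g|^2$.\<close>

lemma nn_integral_cgauss_cell:
  assumes v: "0 < v" and g: "g \<noteq> 0" and a: "0 < a" and [measurable]: "I \<in> sets borel" "J \<in> sets borel"
    and I: "open_cell m a n \<subseteq> I" "I \<subseteq> closed_cell m a n"
    and J: "open_cell m' a n' \<subseteq> J" "J \<subseteq> closed_cell m' a n'"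
  shows "(\<integral>\<^sup>+z. ennreal (cgauss_density v z) * (indicator I (Re (z / g)) * indicator J (Im (z / g))) \<partial>lborel) =
    ennreal (cell_prob m n (gauss_tail (a / sqrt v * cmod g))) *
    ennreal (cell_prob m' n' (gauss_tail (a / sqrt v * cmod g)))"
proof -
  let ?v = "v / (cmod g)\<^sup>2"
  have v': "0 < ?v" using v g by simp
  \<comment> \<open>Measured in the new standard deviation, the half spacing is proportional to
    \<open>cmod g\<close>, as the averages over \<open>c * sqrt x\<close> require.\<close>
  have arg: "a / sqrt ?v = a / sqrt v * cmod g" by (simp add: real_sqrt_divide)
  have "(\<integral>\<^sup>+z. ennreal (cgauss_density v z) * (indicator I (Re (z / g)) * indicator J (Im (z / g))) \<partial>lborel) =
    ennreal ((cmod g)\<^sup>2) * (\<integral>\<^sup>+u. ennreal (cgauss_density v (g * u)) * (indicator I (Re (g * u / g)) * indicator J (Im (g * u / g))) \<partial>lborel)"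
    by (rule nn_integral_complex_mult[OF _ g]) measurable
  also have "\<dots> = (\<integral>\<^sup>+u. ennreal (cgauss_density ?v u) * (indicator I (Re u) * indicator J (Im u)) \<partial>lborel)"
    using g by (subst nn_integral_cmult[symmetric])
      (auto intro!: nn_integral_cong simp: cgauss_density_mult[OF g v, symmetric] ennreal_mult' mult.assoc)
  also have "\<dots> = ennreal (cell_prob m n (gauss_tail (a / sqrt v * cmod g))) *
    ennreal (cell_prob m' n' (gauss_tail (a / sqrt v * cmod g)))"
    using v' by (subst nn_integral_cgauss_rect) (simp_all only: nn_integral_normal_cell[OF _ a _ I] nn_integral_normal_cell[OF _ a _ J] assms arg[symmetric] real_sqrt_gt_zero)
  finally show ?thesis .
qed

lemma gauss_tail_le_half: "0 \<le> c \<Longrightarrow> gauss_tail c \<le> 1 / 2"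
  using gauss_tail_mono[of 0 c] by (simp add: gauss_tail_0)

text \<open>The worst case is a point with two neighbours, \<open>1 - 2 * T\<close>, hence the bound
  \<open>1 / 2\<close>.\<close>

lemma cell_prob_nonneg: "T \<le> 1 / 2 \<Longrightarrow> 0 \<le> cell_prob m n T"
  by (auto simp: cell_prob_def of_bool_def)

definition qam_error :: "nat \<Rightarrow> nat \<Rightarrow> real \<Rightarrow> real" where
  "qam_error MI MQ b = (2 - 1 / real MI - 1 / real MQ) * (1 - 1 / b)
    - 2 * (1 - 1 / real MI) * (1 - 1 / real MQ) * (2 / pi * (1 / b) * arctan (1 / b) - 1 / b + 1 / 2)"

section \<open>Averaging over the exponential law of the squared fading amplitude\<close>

context prob_space
begin

context
  fixes X :: "'a \<Rightarrow> real" and c b :: real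
  assumes X: "distributed M lborel X (\<lambda>x. ennreal (if x \<ge> 0 then exp (- x) else 0))"
    and c: "0 < c" and b: "b = sqrt (1 + 2 / c\<^sup>2)"
begin

lemma measurable_exponential_rv [measurable]: "X \<in> borel_measurable M"
  using distributed_measurable[OF X] by simp

text \<open>Transfers closed forms from nonnegative integrals to real expectations. The sign of
  \<open>B\<close> has to be known because \<open>ennreal\<close> sends negative reals to 0.\<close>

lemma expectation_exponential_eq:
  assumes [measurable]: "g \<in> borel_measurable borel" and g: "\<And>x. 0 \<le> g x" and "0 \<le> B"
    and "(\<integral>\<^sup>+x. ennreal (exp (- x)) * indicator {0..} x * ennreal (g x) \<partial>lborel) = ennreal B"
  shows "expectation (\<lambda>\<omega>. g (X \<omega>)) = B"
proof -
  have "(\<integral>\<^sup>+\<omega>. ennreal (g (X \<omega>)) \<partial>M) = (\<integral>\<^sup>+x. ennreal (if x \<ge> 0 then exp (- x) else 0) * ennreal (g x) \<partial>lborel)"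
    by (rule distributed_nn_integral[OF X, symmetric]) simp
  also have "\<dots> = ennreal B"
    unfolding assms(4)[symmetric] by (intro nn_integral_cong) simp
  finally have "(\<integral>\<^sup>+\<omega>. ennreal (g (X \<omega>)) \<partial>M) = ennreal B" .
  then show ?thesis using \<open>0 \<le> B\<close> g by (subst integral_eq_nn_integral) simp_all
qed

lemma expectation_gauss_tail:
  "expectation (\<lambda>\<omega>. gauss_tail (c * sqrt (X \<omega>))) = 1 / 2 * (1 - 1 / b)"
proof (rule expectation_exponential_eq)
  have "1 \<le> b" unfolding b by simp
  then show "0 \<le> 1 / 2 * (1 - 1 / b)" by simp
qed (simp_all only: gauss_tail_nonneg nn_integral_exponential_gauss_tail[OF c b], measurable)

lemma expectation_gauss_tail_square:
  "expectation (\<lambda>\<omega>. (gauss_tail (c * sqrt (X \<omega>)))\<^sup>2) = 1 / 2 * (2 / pi * (1 / b) * arctan (1 / b) - 1 / b + 1 / 2)"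
    (is "_ = ?B")
proof (rule expectation_exponential_eq)
  have eq: "(\<integral>\<^sup>+x. ennreal (exp (- x)) * indicator {0..} x * ennreal ((gauss_tail (c * sqrt x))\<^sup>2) \<partial>lborel) = ennreal ?B"
    by (rule nn_integral_exponential_gauss_tail_square[OF c b])
  then show "(\<integral>\<^sup>+x. ennreal (exp (- x)) * indicator {0..} x * ennreal ((gauss_tail (c * sqrt x))\<^sup>2) \<partial>lborel) = ennreal ?B" .
  show "0 \<le> ?B"
    by (rule nn_integral_exponential_gauss_tail_square[OF c b])
qed simp_all

text \<open>With the expectation outside, the double sum factors into the two row sums
  \<open>m - 2 * (m - 1) * T\<close>. Their product is quadratic in \<open>T\<close>, so its mean is
  given by the two moments, and dividing by \<open>MI * MQ\<close> leaves
  \<open>1 - qam_error\<close>.\<close>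

lemma expectation_sum_cell_prob:
  assumes "1 \<le> MI" "1 \<le> MQ"
  shows "(\<Sum>n<MI. \<Sum>q<MQ. expectation (\<lambda>\<omega>. cell_prob MI n (gauss_tail (c * sqrt (X \<omega>))) * cell_prob MQ q (gauss_tail (c * sqrt (X \<omega>)))))
    = real MI * real MQ * (1 - qam_error MI MQ b)"
proof -
  let ?T = "\<lambda>\<omega>. gauss_tail (c * sqrt (X \<omega>))"
  have T: "\<bar>?T \<omega>\<bar> \<le> 1" for \<omega> using gauss_tail_nonneg gauss_tail_le_1 by (simp add: abs_le_iff order_trans[OF _ gauss_tail_nonneg])
  have int: "integrable M ?T"
    by (rule integrable_const_bound[of _ 1]) (use T in auto)
  have int2: "integrable M (\<lambda>\<omega>. (?T \<omega>)\<^sup>2)"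
    by (rule integrable_const_bound[of _ 1]) (use T in \<open>auto simp: abs_square_le_1\<close>)
  \<comment> \<open>Expanded by powers of the tail, the product inherits integrability from
    \<open>int\<close> and \<open>int2\<close>.\<close>
  have poly: "cell_prob m n x * cell_prob m' n' x =
      1 - (of_bool (0 < n) + of_bool (Suc n < m) + of_bool (0 < n') + of_bool (Suc n' < m')) * x +
      (of_bool (0 < n) + of_bool (Suc n < m)) * (of_bool (0 < n') + of_bool (Suc n' < m')) * x\<^sup>2" for m n m' n' x
    unfolding cell_prob_def by (simp only: power2_eq_square) algebra
  have "integrable M (\<lambda>\<omega>. cell_prob m n (?T \<omega>) * cell_prob m' n' (?T \<omega>))" for m n m' n'
    unfolding poly using int int2 by simp
  then have "(\<Sum>n<MI. \<Sum>q<MQ. expectation (\<lambda>\<omega>. cell_prob MI n (?T \<omega>) * cell_prob MQ q (?T \<omega>))) =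
      expectation (\<lambda>\<omega>. \<Sum>n<MI. \<Sum>q<MQ. cell_prob MI n (?T \<omega>) * cell_prob MQ q (?T \<omega>))"
    by simp
  also have "\<dots> = expectation (\<lambda>\<omega>. real MI * real MQ - (2 * (real MI - 1) * real MQ + 2 * real MI * (real MQ - 1)) * ?T \<omega>
      + 4 * (real MI - 1) * (real MQ - 1) * (?T \<omega>)\<^sup>2)"
    unfolding sum_product[symmetric] sum_cell_prob[OF assms(1)] sum_cell_prob[OF assms(2)]
    by (intro Bochner_Integration.integral_cong refl) (simp add: algebra_simps power2_eq_square)
  also have "\<dots> = real MI * real MQ - (2 * (real MI - 1) * real MQ + 2 * real MI * (real MQ - 1)) * expectation ?T
      + 4 * (real MI - 1) * (real MQ - 1) * expectation (\<lambda>\<omega>. (?T \<omega>)\<^sup>2)"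
    using int int2 by (simp add: prob_space)
  also have "\<dots> = real MI * real MQ * (1 - qam_error MI MQ b)"
  proof -
    have *: "x - (2 * (x' - 1) * y' + 2 * x' * (y' - 1)) * (1 / 2 * A) + 4 * (x' - 1) * (y' - 1) * (1 / 2 * B) =
        x' * y' * (1 - ((2 - 1 / x' - 1 / y') * A - 2 * (1 - 1 / x') * (1 - 1 / y') * B))"
      if "x = x' * y'" "1 \<le> x'" "1 \<le> y'" for x x' y' A B :: real
      using that by (simp add: field_simps)
    show ?thesis
      unfolding expectation_gauss_tail expectation_gauss_tail_square qam_error_def
      using assms by (intro *) simp_all
  qed
  finally show ?thesis .
qed

end
end

section \<open>Finite mixtures of circular Gaussians\<close>

definition gauss_mix :: "'l set \<Rightarrow> ('l \<Rightarrow> real) \<Rightarrow> ('l \<Rightarrow> real) \<Rightarrow> complex \<Rightarrow> real" where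
  "gauss_mix L w v z = (\<Sum>l\<in>L. w l * cgauss_density (v l) z)"

lemma borel_measurable_gauss_mix [measurable]: "gauss_mix L w v \<in> borel_measurable borel"
  unfolding gauss_mix_def by measurable

context
  fixes L :: "'l set" and w v :: "'l \<Rightarrow> real"
  assumes L: "finite L" and w: "\<And>l. l \<in> L \<Longrightarrow> 0 \<le> w l" "sum w L = 1" and v: "\<And>l. l \<in> L \<Longrightarrow> 0 < v l"
begin

text \<open>Single weights may vanish; positivity and strict decrease of the mixture rest on one
  component that is really present.\<close>

lemma gauss_mix_weight_pos: "\<exists>l\<in>L. 0 < w l"
proof (rule ccontr)
  assume "\<not> ?thesis"
  then have "sum w L = 0" using w(1) by (intro sum.neutral) (meson antisym not_less)
  then show False using w(2) by simp
qed

lemma gauss_mix_pos: "0 < gauss_mix L w v z"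
proof -
  obtain l where l: "l \<in> L" "0 < w l" using gauss_mix_weight_pos by blast
  show ?thesis
    unfolding gauss_mix_def using l w(1) v
    by (intro sum_pos2[OF L l(1)] mult_pos_pos mult_nonneg_nonneg) (auto intro: cgauss_density_pos less_imp_le)
qed

text \<open>Strictness is what later forces a maximizer of the weighted density to be a nearest
  point.\<close>

lemma gauss_mix_strict_antimono:
  assumes "cmod z < cmod z'"
  shows "gauss_mix L w v z' < gauss_mix L w v z"
proof -
  have less: "cgauss_density (v l) z' < cgauss_density (v l) z" if "l \<in> L" for l
    using v[OF that] assms by (simp add: cgauss_density_def divide_strict_right_mono power_strict_mono)
  obtain l where l: "l \<in> L" "0 < w l" using gauss_mix_weight_pos by blast
  show ?thesis
    unfolding gauss_mix_def using l w(1) less L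
    by (intro sum_strict_mono_ex1) (auto intro!: mult_left_mono mult_strict_left_mono bexI[of _ l] dest: less_imp_le)
qed

lemma nn_integral_gauss_mix:
  assumes [measurable]: "f \<in> borel_measurable borel"
  shows "(\<integral>\<^sup>+z. ennreal (gauss_mix L w v z) * f z \<partial>lborel) = (\<Sum>l\<in>L. ennreal (w l) * (\<integral>\<^sup>+z. ennreal (cgauss_density (v l) z) * f z \<partial>lborel))"
proof -
  have "(\<integral>\<^sup>+z. ennreal (gauss_mix L w v z) * f z \<partial>lborel) =
      (\<integral>\<^sup>+z. (\<Sum>l\<in>L. ennreal (w l) * (ennreal (cgauss_density (v l) z) * f z)) \<partial>lborel)"
  proof (rule nn_integral_cong)
    fix z
    have "ennreal (gauss_mix L w v z) = (\<Sum>l\<in>L. ennreal (w l) * ennreal (cgauss_density (v l) z))"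
      unfolding gauss_mix_def using w(1) v cgauss_density_pos[THEN less_imp_le]
      by (subst sum_ennreal[symmetric]) (simp_all add: ennreal_mult)
    then show "ennreal (gauss_mix L w v z) * f z = (\<Sum>l\<in>L. ennreal (w l) * (ennreal (cgauss_density (v l) z) * f z))"
      by (simp add: sum_distrib_right mult.assoc)
  qed
  then show ?thesis by (simp add: nn_integral_sum nn_integral_cmult)
qed

text \<open>Convolution is linear in the mixture, so it acts on each component and leaves the
  weights alone.\<close>

lemma gauss_mix_add_noise:
  assumes s: "0 < s"
  shows "(\<integral>\<^sup>+u. ennreal (cgauss_density s (z - u)) * ennreal (gauss_mix L w v u) \<partial>lborel) =
    ennreal (gauss_mix L w (\<lambda>l. v l + s) z)"
proof -
  have "(\<integral>\<^sup>+u. ennreal (cgauss_density s (z - u)) * ennreal (gauss_mix L w v u) \<partial>lborel) =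
      (\<integral>\<^sup>+u. ennreal (gauss_mix L w v u) * ennreal (cgauss_density s (z - u)) \<partial>lborel)"
    by (simp add: mult.commute)
  also have "\<dots> = (\<Sum>l\<in>L. ennreal (w l) * (\<integral>\<^sup>+u. ennreal (cgauss_density s (z - u)) * ennreal (cgauss_density (v l) u) \<partial>lborel))"
    by (subst nn_integral_gauss_mix) (simp_all add: mult.commute)
  also have "\<dots> = (\<Sum>l\<in>L. ennreal (w l) * ennreal (cgauss_density (v l + s) z))"
    using v s by (intro sum.cong refl) (simp add: cgauss_density_convolution add.commute)
  also have "\<dots> = ennreal (gauss_mix L w (\<lambda>l. v l + s) z)"
    unfolding gauss_mix_def using w(1) v s cgauss_density_pos[THEN less_imp_le]
    by (subst sum_ennreal[symmetric]) (simp_all add: ennreal_mult add_pos_pos)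
  finally show ?thesis .
qed

lemma nn_integral_gauss_mix_cell:
  assumes g: "g \<noteq> 0" and a: "0 < a" and [measurable]: "I \<in> sets borel" "J \<in> sets borel"
    and I: "open_cell m a n \<subseteq> I" "I \<subseteq> closed_cell m a n"
    and J: "open_cell m' a n' \<subseteq> J" "J \<subseteq> closed_cell m' a n'"
  shows "(\<integral>\<^sup>+z. ennreal (gauss_mix L w v z) * (indicator I (Re (z / g)) * indicator J (Im (z / g))) \<partial>lborel) =
    ennreal (\<Sum>l\<in>L. w l * (cell_prob m n (gauss_tail (a / sqrt (v l) * cmod g)) * cell_prob m' n' (gauss_tail (a / sqrt (v l) * cmod g))))"
proof -
  have nonneg: "0 \<le> cell_prob m n (gauss_tail (a / sqrt (v l) * cmod g))" if "l \<in> L" for l m n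
    using a v[OF that] by (intro cell_prob_nonneg gauss_tail_le_half) simp
  have "(\<integral>\<^sup>+z. ennreal (gauss_mix L w v z) * (indicator I (Re (z / g)) * indicator J (Im (z / g))) \<partial>lborel) =
      (\<Sum>l\<in>L. ennreal (w l) * (ennreal (cell_prob m n (gauss_tail (a / sqrt (v l) * cmod g))) *
        ennreal (cell_prob m' n' (gauss_tail (a / sqrt (v l) * cmod g)))))"
    by (subst nn_integral_gauss_mix, measurable)
       (intro sum.cong refl arg_cong2[where f="(*)"] nn_integral_cgauss_cell v g a assms)
  also have "\<dots> = (\<Sum>l\<in>L. ennreal (w l * (cell_prob m n (gauss_tail (a / sqrt (v l) * cmod g)) * cell_prob m' n' (gauss_tail (a / sqrt (v l) * cmod g)))))"
    using nonneg w(1) by (intro sum.cong refl) (simp add: ennreal_mult)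
  also have "\<dots> = ennreal (\<Sum>l\<in>L. w l * (cell_prob m n (gauss_tail (a / sqrt (v l) * cmod g)) * cell_prob m' n' (gauss_tail (a / sqrt (v l) * cmod g))))"
    using nonneg w(1) by (intro sum_ennreal) simp
  finally show ?thesis .
qed

end

section \<open>Translation invariance and sums of independent vectors\<close>

lemma nn_integral_lborel_translate:
  fixes f :: "'a::euclidean_space \<Rightarrow> ennreal"
  assumes [measurable]: "f \<in> borel_measurable borel"
  shows "(\<integral>\<^sup>+x. f (c + x) \<partial>lborel) = (\<integral>\<^sup>+x. f x \<partial>lborel)"
  by (subst (2) lborel_distr_plus[of c, symmetric]) (simp add: nn_integral_distr)

text \<open>Independence makes the joint law a product. For fixed \<open>y\<close> the inner
  integral is translated to the variable \<open>z = x + y\<close>, and exchanging the integrals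
  exhibits the convolution as a density.\<close>

lemma (in prob_space) distributed_add_indep:
  fixes X Y :: "'a \<Rightarrow> 'b::euclidean_space"
  assumes ind: "indep_var borel X borel Y"
    and X: "distributed M lborel X f" and Y: "distributed M lborel Y g"
  shows "distributed M lborel (\<lambda>\<omega>. X \<omega> + Y \<omega>) (\<lambda>z. \<integral>\<^sup>+y. f (z - y) * g y \<partial>lborel)"
  unfolding distributed_def
proof (intro conjI measure_eqI)
  have [measurable]: "f \<in> borel_measurable borel" "g \<in> borel_measurable borel" "X \<in> borel_measurable M" "Y \<in> borel_measurable M"
    using distributed_borel_measurable[OF X] distributed_borel_measurable[OF Y] distributed_measurable[OF X] distributed_measurable[OF Y] by simp_all
  show "(\<lambda>\<omega>. X \<omega> + Y \<omega>) \<in> measurable M lborel" by simp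
  show "(\<lambda>z. \<integral>\<^sup>+y. f (z - y) * g y \<partial>lborel) \<in> borel_measurable lborel" by simp
  interpret X: prob_space "distr M borel X" by (rule prob_space_distr) simp
  interpret Y: prob_space "distr M borel Y" by (rule prob_space_distr) simp
  interpret XY: pair_prob_space "distr M borel X" "distr M borel Y" ..
  have dX: "distr M borel X = density lborel f" and dY: "distr M borel Y = density lborel g"
    using distributed_distr_eq_density[OF X] distributed_distr_eq_density[OF Y] by (simp_all cong: distr_cong)
  fix A assume "A \<in> sets (distr M lborel (\<lambda>\<omega>. X \<omega> + Y \<omega>))"
  then have [measurable]: "A \<in> sets borel" by simp
  have "emeasure (distr M lborel (\<lambda>\<omega>. X \<omega> + Y \<omega>)) A = (\<integral>\<^sup>+x. indicator A x \<partial>distr M lborel (\<lambda>\<omega>. X \<omega> + Y \<omega>))"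
    by (rule nn_integral_indicator[symmetric]) simp
  also have "\<dots> = (\<integral>\<^sup>+\<omega>. indicator A (X \<omega> + Y \<omega>) \<partial>M)"
    by (rule nn_integral_distr) simp_all
  also have "\<dots> = (\<integral>\<^sup>+p. indicator A (fst p + snd p) \<partial>distr M (borel \<Otimes>\<^sub>M borel) (\<lambda>\<omega>. (X \<omega>, Y \<omega>)))"
    by (simp add: nn_integral_distr)
  also have "\<dots> = (\<integral>\<^sup>+p. indicator A (fst p + snd p) \<partial>(distr M borel X \<Otimes>\<^sub>M distr M borel Y))"
    using ind by (simp add: indep_var_distribution_eq)
  also have "\<dots> = (\<integral>\<^sup>+y. (\<integral>\<^sup>+x. indicator A (x + y) \<partial>distr M borel X) \<partial>distr M borel Y)"
    by (subst XY.nn_integral_snd[symmetric]) simp_all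
  also have "\<dots> = (\<integral>\<^sup>+y. g y * (\<integral>\<^sup>+x. f x * indicator A (x + y) \<partial>lborel) \<partial>lborel)"
    unfolding dX dY by (simp add: nn_integral_density)
  also have "\<dots> = (\<integral>\<^sup>+y. (\<integral>\<^sup>+z. f (z - y) * g y * indicator A z \<partial>lborel) \<partial>lborel)"
  proof (rule nn_integral_cong)
    fix y
    have "g y * (\<integral>\<^sup>+x. f x * indicator A (x + y) \<partial>lborel) = (\<integral>\<^sup>+x. g y * (f x * indicator A (x + y)) \<partial>lborel)"
      by (rule nn_integral_cmult[symmetric]) simp
    also have "\<dots> = (\<integral>\<^sup>+z. g y * (f (- y + z) * indicator A ((- y + z) + y)) \<partial>lborel)"
      by (rule nn_integral_lborel_translate[symmetric]) simp
    finally show "g y * (\<integral>\<^sup>+x. f x * indicator A (x + y) \<partial>lborel) = (\<integral>\<^sup>+z. f (z - y) * g y * indicator A z \<partial>lborel)"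
      by (simp add: mult_ac)
  qed
  also have "\<dots> = (\<integral>\<^sup>+z. (\<integral>\<^sup>+y. f (z - y) * g y * indicator A z \<partial>lborel) \<partial>lborel)"
    by (intro lborel_pair.Fubini') simp
  also have "\<dots> = emeasure (density lborel (\<lambda>z. \<integral>\<^sup>+y. f (z - y) * g y \<partial>lborel)) A"
    by (simp add: emeasure_density nn_integral_multc)
  finally show "emeasure (distr M lborel (\<lambda>\<omega>. X \<omega> + Y \<omega>)) A = emeasure (density lborel (\<lambda>z. \<integral>\<^sup>+y. f (z - y) * g y \<partial>lborel)) A" .
qed simp

section \<open>Nearest constellation points\<close>

text \<open>\<open>x\<close> is the residual relative to point \<open>n\<close>, and
  \<open>x + d * (real n - real n')\<close> is the one relative to point \<open>n'\<close>. With
  \<open>k\<close> the index difference, the squares differ by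
  \<open>d * k * (2 * x + d * k)\<close>. Both factors have the sign of \<open>k\<close>, because
  \<open>k\<close> is a nonzero integer and \<open>x\<close> stays within \<open>d / 2\<close> on
  the side of \<open>n'\<close>.\<close>

lemma open_cell_nearest:
  assumes "0 < d" "x \<in> open_cell m (d / 2) n" "n' < m"
  shows "x\<^sup>2 \<le> (x + d * (real n - real n'))\<^sup>2" and "n' \<noteq> n \<Longrightarrow> x\<^sup>2 < (x + d * (real n - real n'))\<^sup>2"
proof -
  let ?k = "real n - real n'"
  have *: "(x + d * ?k)\<^sup>2 - x\<^sup>2 = (d * ?k) * (2 * x + d * ?k)"
    by (simp add: power2_eq_square algebra_simps)
  show less: "x\<^sup>2 < (x + d * ?k)\<^sup>2" if "n' \<noteq> n"
  proof (cases "n' < n")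
    case True
    then have "0 < d * 1" "d * 1 \<le> d * ?k" using assms(1) by (auto intro!: mult_left_mono)
    moreover have "- (d / 2) < x" using assms(2) True by (auto simp: open_cell_def)
    ultimately have "0 < (d * ?k) * (2 * x + d * ?k)" by (intro mult_pos_pos[of "d * ?k"]) linarith+
    then show ?thesis using * by simp
  next
    case False
    then have "0 < d" "d * ?k \<le> d * (- 1)" using assms(1) that by (simp_all only: mult_le_cancel_left_pos)
    moreover have "x < d / 2" using assms(2,3) False that by (auto simp: open_cell_def)
    ultimately have "0 < (d * ?k) * (2 * x + d * ?k)" by (intro mult_neg_neg[of "d * ?k"]) linarith+
    then show ?thesis using * by simp
  qed
  show "x\<^sup>2 \<le> (x + d * ?k)\<^sup>2" using less by (cases "n' = n") auto
qed

text \<open>Comparison with the immediate neighbours \<open>n - 1\<close> and \<open>n + 1\<close>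
  already gives the two bounds.\<close>

lemma nearest_closed_cell:
  assumes "0 < d" and le: "\<And>n'. n' < m \<Longrightarrow> x\<^sup>2 \<le> (x + d * (real n - real n'))\<^sup>2" and "n < m"
  shows "x \<in> closed_cell m (d / 2) n"
proof -
  have "- (d / 2) \<le> x" if "0 < n"
  proof -
    have "x\<^sup>2 \<le> (x + d)\<^sup>2" using le[of "n - 1"] that \<open>n < m\<close> by (simp add: of_nat_diff)
    then have "0 \<le> d * (2 * x + d)" by (simp add: power2_eq_square algebra_simps)
    then show ?thesis using \<open>0 < d\<close> by (simp add: zero_le_mult_iff)
  qed
  moreover have "x \<le> d / 2" if "Suc n < m"
  proof -
    have "x\<^sup>2 \<le> (x - d)\<^sup>2" using le[OF that] by simp
    then have "0 \<le> d * (d - 2 * x)" by (simp add: power2_eq_square algebra_simps)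
    then show ?thesis using \<open>0 < d\<close> by (simp add: zero_le_mult_iff)
  qed
  ultimately show ?thesis by (simp add: closed_cell_def)
qed

section \<open>From rows to the planar constellation\<close>

definition qam_point :: "nat \<Rightarrow> nat \<Rightarrow> real \<Rightarrow> nat \<Rightarrow> nat \<Rightarrow> complex" where
  "qam_point MI MQ d n q = Complex (qam_coord MI d n) (qam_coord MQ d q)"

text \<open>With \<open>g\<close> factored out, the residual is \<open>z / g\<close> plus a
  difference of two constellation points, so the squared distance separates into the coordinates
  treated above.\<close>

lemma qam_residual:
  assumes "g \<noteq> 0"
  shows "(cmod (g * qam_point MI MQ d n q + z - g * qam_point MI MQ d n' q'))\<^sup>2 =
    (cmod g)\<^sup>2 * ((Re (z / g) + d * (real n - real n'))\<^sup>2 + (Im (z / g) + d * (real q - real q'))\<^sup>2)"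
proof -
  have "qam_point MI MQ d n q - qam_point MI MQ d n' q' = Complex (d * (real n - real n')) (d * (real q - real q'))"
    by (simp add: qam_point_def qam_coord_def complex_eq_iff algebra_simps)
  moreover have "g * qam_point MI MQ d n q + z - g * qam_point MI MQ d n' q' =
      g * (z / g + (qam_point MI MQ d n q - qam_point MI MQ d n' q'))"
    using assms by (simp add: field_simps)
  ultimately show ?thesis
    by (simp add: norm_mult power_mult_distrib cmod_power2)
qed

text \<open>Each coordinate weakly favours its own index, and one of them does so strictly because
  the index pairs differ.\<close>

lemma nearest_qam_point_if_open_cell:
  assumes "0 < d" "g \<noteq> 0" "Re (z / g) \<in> open_cell MI (d / 2) n" "Im (z / g) \<in> open_cell MQ (d / 2) q"
    and "n' < MI" "q' < MQ" "(n', q') \<noteq> (n, q)"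
  shows "cmod (g * qam_point MI MQ d n q + z - g * qam_point MI MQ d n q) < cmod (g * qam_point MI MQ d n q + z - g * qam_point MI MQ d n' q')"
proof -
  have "(Re (z / g))\<^sup>2 + (Im (z / g))\<^sup>2 < (Re (z / g) + d * (real n - real n'))\<^sup>2 + (Im (z / g) + d * (real q - real q'))\<^sup>2"
    using open_cell_nearest[OF assms(1,3,5)] open_cell_nearest[OF assms(1,4,6)] assms(7)
    by (cases "n' = n") (auto intro: add_le_less_mono add_less_le_mono)
  then have "(cmod (g * qam_point MI MQ d n q + z - g * qam_point MI MQ d n q))\<^sup>2 < (cmod (g * qam_point MI MQ d n q + z - g * qam_point MI MQ d n' q'))\<^sup>2"
    unfolding qam_residual[OF assms(2)] using assms(2) by simp
  then show ?thesis by (rule power2_less_imp_less) simp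
qed

text \<open>Varying one index while the other keeps its own value cancels the second coordinate and
  leaves a comparison along a row.\<close>

lemma closed_cell_if_nearest_qam_point:
  assumes "0 < d" "g \<noteq> 0" "n < MI" "q < MQ"
    and le: "\<And>n' q'. n' < MI \<Longrightarrow> q' < MQ \<Longrightarrow> cmod (g * qam_point MI MQ d n q + z - g * qam_point MI MQ d n q) \<le> cmod (g * qam_point MI MQ d n q + z - g * qam_point MI MQ d n' q')"
  shows "Re (z / g) \<in> closed_cell MI (d / 2) n" "Im (z / g) \<in> closed_cell MQ (d / 2) q"
proof -
  have sq: "(Re (z / g))\<^sup>2 + (Im (z / g))\<^sup>2 \<le> (Re (z / g) + d * (real n - real n'))\<^sup>2 + (Im (z / g) + d * (real q - real q'))\<^sup>2"
    if "n' < MI" "q' < MQ" for n' q'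
  proof -
    have "(cmod (g * qam_point MI MQ d n q + z - g * qam_point MI MQ d n q))\<^sup>2 \<le> (cmod (g * qam_point MI MQ d n q + z - g * qam_point MI MQ d n' q'))\<^sup>2"
      by (intro power_mono le that) simp
    then show ?thesis unfolding qam_residual[OF assms(2)] using assms(2) by simp
  qed
  show "Re (z / g) \<in> closed_cell MI (d / 2) n"
    using sq[OF _ \<open>q < MQ\<close>] assms by (intro nearest_closed_cell) simp_all
  show "Im (z / g) \<in> closed_cell MQ (d / 2) q"
    using sq[OF \<open>n < MI\<close>] assms by (intro nearest_closed_cell) simp_all
qed

lemma qam_point_inject:
  assumes "0 < d"
  shows "qam_point MI MQ d n q = qam_point MI MQ d n' q' \<longleftrightarrow> n = n' \<and> q = q'"
  using assms by (auto simp: qam_point_def qam_coord_def)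

section \<open>The received signal\<close>

text \<open>The model states independence for the pair \<open>(N, W)\<close>, so an event about the
  total noise has to be a measurable set of such pairs.\<close>

lemma noise_pairs_measurable:
  fixes B :: "complex set"
  assumes [measurable]: "B \<in> sets borel"
  shows "{nw. (if j = (0::nat) then fst nw else fst nw + snd nw) \<in> B} \<in> sets (borel \<Otimes>\<^sub>M borel)"
proof -
  have "(\<lambda>nw. if j = 0 then fst nw else fst nw + snd nw) -` B \<inter> space (borel \<Otimes>\<^sub>M borel) \<in> sets (borel \<Otimes>\<^sub>M borel)"
    by (rule measurable_sets[of _ _ borel]) measurable
  then show ?thesis by (simp add: vimage_def space_pair_measure)
qed

context sss_qam_rayleigh
begin

definition noise :: "nat \<Rightarrow> 'a \<Rightarrow> complex" where
  "noise j \<omega> = (if j = 0 then N \<omega> else N \<omega> + W \<omega>)"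

text \<open>The idle state is treated as a mixture with a single component of weight 1, so that both
  states share all arguments below.\<close>

definition mix_index :: "nat \<Rightarrow> nat set" where
  "mix_index j = (if j = 0 then {0} else {1..p})"

definition mix_weight :: "nat \<Rightarrow> nat \<Rightarrow> real" where
  "mix_weight j l = (if j = 0 then 1 else lam l)"

definition mix_var :: "nat \<Rightarrow> nat \<Rightarrow> real" where
  "mix_var j l = (if j = 0 then \<sigma>n\<^sup>2 else (\<sigma> l)\<^sup>2 + \<sigma>n\<^sup>2)"

abbreviation noise_density :: "nat \<Rightarrow> complex \<Rightarrow> real" where
  "noise_density j \<equiv> gauss_mix (mix_index j) (mix_weight j) (mix_var j)"

lemma mix:
  shows "finite (mix_index j)" "\<And>l. l \<in> mix_index j \<Longrightarrow> 0 \<le> mix_weight j l"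
    "sum (mix_weight j) (mix_index j) = 1" "\<And>l. l \<in> mix_index j \<Longrightarrow> 0 < mix_var j l"
  using mixture_weight_nonneg mixture_weight_sum noise_var_pos mixture_var_pos
  by (auto simp: mix_index_def mix_weight_def mix_var_def intro: add_pos_pos)

lemma measurable_rvs [measurable]:
  "H \<in> measurable M (count_space {0,1})" "D \<in> measurable M (count_space {0,1})"
  "S \<in> borel_measurable M" "h \<in> borel_measurable M" "N \<in> borel_measurable M" "W \<in> borel_measurable M"
  by (fact H_rv D_rv S_rv h_rv N_rv W_rv)+

lemma measurable_noise [measurable]: "noise j \<in> borel_measurable M"
  unfolding noise_def by measurable

lemma state_decision_event [measurable]: "{\<omega> \<in> space M. H \<omega> = j \<and> D \<omega> = k} \<in> events"
proof -
  \<comment> \<open>Intersecting with \<open>{0,1}\<close> also covers other values of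
    \<open>j\<close> and \<open>k\<close>, for which the event is empty.\<close>
  have "H -` ({j} \<inter> {0,1}) \<inter> space M \<in> events" "D -` ({k} \<inter> {0,1}) \<inter> space M \<in> events"
    by (rule measurable_sets[OF H_rv], simp, rule measurable_sets[OF D_rv], simp)
  moreover have "{\<omega> \<in> space M. H \<omega> = j \<and> D \<omega> = k} =
      (H -` ({j} \<inter> {0,1}) \<inter> space M) \<inter> (D -` ({k} \<inter> {0,1}) \<inter> space M)"
    using measurable_space[OF H_rv] measurable_space[OF D_rv] by auto
  ultimately show ?thesis by auto
qed

lemma symbol_event [measurable]: "{\<omega> \<in> space M. D \<omega> = k \<and> H \<omega> = j \<and> S \<omega> = s} \<in> events"
proof -
  have "{\<omega> \<in> space M. D \<omega> = k \<and> H \<omega> = j \<and> S \<omega> = s} = {\<omega> \<in> space M. H \<omega> = j \<and> D \<omega> = k} \<inter> (S -` {s} \<inter> space M)"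
    by auto
  also have "\<dots> \<in> events" by measurable
  finally show ?thesis .
qed

section \<open>Laws of noise, symbol and fading for a state and decision of positive
  probability\<close>

context
  fixes j k :: nat
  assumes j: "j \<in> {0,1}" and k: "k \<in> {0,1}" and pos: "prob {\<omega> \<in> space M. H \<omega> = j \<and> D \<omega> = k} > 0"
begin

lemma prob_space_cond_space: "prob_space (cond_space M H D j k)"
  using pos by (intro prob_space_uniform_measure) (auto simp: emeasure_eq_measure)

lemma noise_distributed:
  "distributed (cond_space M H D j k) lborel (noise j) (\<lambda>z. ennreal (noise_density j z))"
proof -
  interpret C: prob_space "cond_space M H D j k" by (rule prob_space_cond_space)
  show ?thesis
  proof (cases "j = 0")
    case True
    then show ?thesis
      using noise_distr[OF j k pos]
      by (simp add: noise_def[abs_def] mix_index_def mix_weight_def mix_var_def gauss_mix_def[abs_def])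
  next
    case False
    have mix': "finite {1..p}" "\<And>l. l \<in> {1..p} \<Longrightarrow> 0 \<le> lam l" "sum lam {1..p} = 1" "\<And>l. l \<in> {1..p} \<Longrightarrow> 0 < (\<sigma> l)\<^sup>2"
      using mixture_weight_nonneg mixture_weight_sum mixture_var_pos by simp_all
    have gm: "cgauss_mixture_density p lam \<sigma> = gauss_mix {1..p} lam (\<lambda>l. (\<sigma> l)\<^sup>2)"
      by (simp add: cgauss_mixture_density_def gauss_mix_def fun_eq_iff)
    have "distributed (cond_space M H D j k) lborel (\<lambda>\<omega>. N \<omega> + W \<omega>)
      (\<lambda>z. \<integral>\<^sup>+y. ennreal (cgauss_density (\<sigma>n\<^sup>2) (z - y)) * ennreal (cgauss_mixture_density p lam \<sigma> y) \<partial>lborel)"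
      using noise_interference_indep[OF j k pos] noise_distr[OF j k pos] interference_distr[OF j k pos]
      by (rule C.distributed_add_indep)
    moreover have "(\<integral>\<^sup>+y. ennreal (cgauss_density (\<sigma>n\<^sup>2) (z - y)) * ennreal (cgauss_mixture_density p lam \<sigma> y) \<partial>lborel) =
        ennreal (gauss_mix {1..p} lam (\<lambda>l. (\<sigma> l)\<^sup>2 + \<sigma>n\<^sup>2) z)" for z
      unfolding gm by (rule gauss_mix_add_noise[OF mix' noise_var_pos])
    ultimately show ?thesis
      using False by (simp add: noise_def[abs_def] mix_index_def mix_weight_def[abs_def] mix_var_def[abs_def])
  qed
qed

text \<open>In the conditional space the symbol is independent of \<open>(N, W)\<close>, hence of
  the total noise. Multiplying by the probability of the condition returns to the original space,
  where the independence of the fading is stated.\<close>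

lemma prob_noise_symbol:
  assumes s: "s \<in> qam_constellation MI MQ (P k)" and B [measurable]: "B \<in> sets borel"
  shows "prob {\<omega> \<in> space M. noise j \<omega> \<in> B \<and> D \<omega> = k \<and> H \<omega> = j \<and> S \<omega> = s} =
    prob {\<omega> \<in> space M. H \<omega> = j \<and> D \<omega> = k} / (real MI * real MQ) * measure (density lborel (noise_density j)) B"
proof -
  let ?C = "cond_space M H D j k" and ?E = "{\<omega> \<in> space M. H \<omega> = j \<and> D \<omega> = k}"
  interpret C: prob_space ?C by (rule prob_space_cond_space)
  let ?T = "{nw :: complex \<times> complex. (if j = 0 then fst nw else fst nw + snd nw) \<in> B}"
  note T = noise_pairs_measurable[OF B, of j]
  have NW: "(\<lambda>\<omega>. (N \<omega>, W \<omega>)) -` ?T \<inter> space ?C = {\<omega> \<in> space M. noise j \<omega> \<in> B}"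
    by (auto simp: noise_def)
  have ind: "C.indep_set {S -` U \<inter> space ?C | U. U \<in> sets borel} {(\<lambda>\<omega>. (N \<omega>, W \<omega>)) -` V \<inter> space ?C | V. V \<in> sets (borel \<Otimes>\<^sub>M borel)}"
    using symbol_indep[OF j k pos] by (simp add: indep_rvs_def)
  have "C.prob ((S -` {s} \<inter> space ?C) \<inter> ((\<lambda>\<omega>. (N \<omega>, W \<omega>)) -` ?T \<inter> space ?C)) =
      C.prob (S -` {s} \<inter> space ?C) * C.prob ((\<lambda>\<omega>. (N \<omega>, W \<omega>)) -` ?T \<inter> space ?C)"
    using T by (intro C.indep_setD[OF ind]) (auto intro!: exI[of _ "{s}"] exI[of _ ?T])
  also have "S -` {s} \<inter> space ?C = {\<omega> \<in> space M. S \<omega> = s}" by auto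
  also have "C.prob {\<omega> \<in> space M. S \<omega> = s} = 1 / (real MI * real MQ)"
    by (rule symbol_uniform[OF j k pos s])
  also note NW
  also have "C.prob {\<omega> \<in> space M. noise j \<omega> \<in> B} = measure (density lborel (noise_density j)) B"
  proof -
    have "C.prob {\<omega> \<in> space M. noise j \<omega> \<in> B} = measure (distr ?C lborel (noise j)) B"
      by (subst measure_distr) (auto simp: vimage_def Int_def conj_commute)
    then show ?thesis by (simp add: distributed_distr_eq_density[OF noise_distributed])
  qed
  also have "C.prob ({\<omega> \<in> space M. S \<omega> = s} \<inter> {\<omega> \<in> space M. noise j \<omega> \<in> B}) =
      prob {\<omega> \<in> space M. noise j \<omega> \<in> B \<and> D \<omega> = k \<and> H \<omega> = j \<and> S \<omega> = s} / prob ?E"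
  proof -
    have "?E \<inter> ({\<omega> \<in> space M. S \<omega> = s} \<inter> {\<omega> \<in> space M. noise j \<omega> \<in> B}) =
        {\<omega> \<in> space M. noise j \<omega> \<in> B \<and> D \<omega> = k \<and> H \<omega> = j \<and> S \<omega> = s}" by auto
    then show ?thesis
      using pos by (subst measure_uniform_measure) (auto simp: emeasure_eq_measure)
  qed
  finally show ?thesis using pos by (simp add: field_simps)
qed

text \<open>State, decision, symbol and noise together form a single event of the tuple of which the
  fading is independent, so the fading factors out without conditioning.\<close>

lemma prob_fading_noise_symbol:
  assumes s: "s \<in> qam_constellation MI MQ (P k)" and A [measurable]: "A \<in> sets borel" and B [measurable]: "B \<in> sets borel"
  shows "prob {\<omega> \<in> space M. (h \<omega> \<in> A \<and> noise j \<omega> \<in> B) \<and> D \<omega> = k \<and> H \<omega> = j \<and> S \<omega> = s} =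
    prob {\<omega> \<in> space M. H \<omega> = j \<and> D \<omega> = k} / (real MI * real MQ) *
    (measure (distr M borel h) A * measure (density lborel (noise_density j)) B)"
proof -
  let ?Q = "count_space {0::nat,1} \<Otimes>\<^sub>M count_space {0::nat,1} \<Otimes>\<^sub>M borel \<Otimes>\<^sub>M borel \<Otimes>\<^sub>M borel :: (nat \<times> nat \<times> complex \<times> complex \<times> complex) measure"
  let ?R = "\<lambda>\<omega>. (H \<omega>, D \<omega>, S \<omega>, N \<omega>, W \<omega>)"
  let ?T = "{nw :: complex \<times> complex. (if j = 0 then fst nw else fst nw + snd nw) \<in> B}"
  note T = noise_pairs_measurable[OF B, of j]
  let ?V = "{j} \<times> {k} \<times> {s} \<times> ?T"
  have V: "?V \<in> sets ?Q"
    using j k T by (intro pair_measureI) auto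
  have ind: "indep_set {h -` U \<inter> space M | U. U \<in> sets borel} {?R -` V \<inter> space M | V. V \<in> sets ?Q}"
    using fading_indep unfolding indep_rvs_def by blast
  have "prob ((h -` A \<inter> space M) \<inter> (?R -` ?V \<inter> space M)) = prob (h -` A \<inter> space M) * prob (?R -` ?V \<inter> space M)"
    using A V by (intro indep_setD[OF ind]) blast+
  also have "?R -` ?V \<inter> space M = {\<omega> \<in> space M. noise j \<omega> \<in> B \<and> D \<omega> = k \<and> H \<omega> = j \<and> S \<omega> = s}"
    by (auto simp: noise_def)
  also have "(h -` A \<inter> space M) \<inter> {\<omega> \<in> space M. noise j \<omega> \<in> B \<and> D \<omega> = k \<and> H \<omega> = j \<and> S \<omega> = s} =
      {\<omega> \<in> space M. (h \<omega> \<in> A \<and> noise j \<omega> \<in> B) \<and> D \<omega> = k \<and> H \<omega> = j \<and> S \<omega> = s}"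
    by auto
  finally show ?thesis
    by (simp add: prob_noise_symbol[OF s B] measure_distr)
qed

lemma prob_space_noise: "prob_space (density lborel (noise_density j))"
proof -
  interpret C: prob_space "cond_space M H D j k" by (rule prob_space_cond_space)
  show ?thesis
    unfolding distributed_distr_eq_density[OF noise_distributed, symmetric]
    by (rule C.prob_space_distr) simp
qed

lemma prob_symbol:
  assumes s: "s \<in> qam_constellation MI MQ (P k)"
  shows "prob {\<omega> \<in> space M. D \<omega> = k \<and> H \<omega> = j \<and> S \<omega> = s} =
    prob {\<omega> \<in> space M. H \<omega> = j \<and> D \<omega> = k} / (real MI * real MQ)"
proof -
  interpret n: prob_space "density lborel (noise_density j)" by (rule prob_space_noise)
  show ?thesis using prob_noise_symbol[OF s, of UNIV] n.prob_space by simp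
qed

section \<open>Joint law of fading and received signal for a given symbol\<close>

context
  fixes s :: complex
  assumes s: "s \<in> qam_constellation MI MQ (P k)"
begin

abbreviation "symbol_space \<equiv> uniform_measure M {\<omega> \<in> space M. D \<omega> = k \<and> H \<omega> = j \<and> S \<omega> = s}"

lemma prob_symbol_pos: "0 < prob {\<omega> \<in> space M. D \<omega> = k \<and> H \<omega> = j \<and> S \<omega> = s}"
  unfolding prob_symbol[OF s] using pos MI MQ by simp

lemma prob_space_symbol_space: "prob_space symbol_space"
  using prob_symbol_pos by (intro prob_space_uniform_measure) (auto simp: emeasure_eq_measure)

text \<open>A product of sigma-finite measures is determined by rectangles. There the conditional
  probability is a quotient of the formulas above, in which the probability of the symbol event
  cancels.\<close>

lemma distr_fading_noise:
  "distr symbol_space (borel \<Otimes>\<^sub>M borel) (\<lambda>\<omega>. (h \<omega>, noise j \<omega>)) = distr M borel h \<Otimes>\<^sub>M density lborel (noise_density j)"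
proof (rule pair_measure_eqI[symmetric])
  interpret h: prob_space "distr M borel h" by (rule prob_space_distr) simp
  interpret n: prob_space "density lborel (noise_density j)" by (rule prob_space_noise)
  show "sigma_finite_measure (distr M borel h)" ..
  show "sigma_finite_measure (density lborel (noise_density j))" ..
  show "sets (distr M borel h \<Otimes>\<^sub>M density lborel (noise_density j)) =
      sets (distr symbol_space (borel \<Otimes>\<^sub>M borel) (\<lambda>\<omega>. (h \<omega>, noise j \<omega>)))"
    by (simp cong: sets_pair_measure_cong)
  let ?E = "{\<omega> \<in> space M. D \<omega> = k \<and> H \<omega> = j \<and> S \<omega> = s}"
  interpret C: prob_space symbol_space by (rule prob_space_symbol_space)
  fix A B assume "A \<in> sets (distr M borel h)" "B \<in> sets (density lborel (noise_density j))"
  then have [measurable]: "A \<in> sets borel" "B \<in> sets borel" by simp_all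
  have "emeasure (distr symbol_space (borel \<Otimes>\<^sub>M borel) (\<lambda>\<omega>. (h \<omega>, noise j \<omega>))) (A \<times> B) =
      emeasure symbol_space {\<omega> \<in> space M. h \<omega> \<in> A \<and> noise j \<omega> \<in> B}"
  proof (subst emeasure_distr)
    have "(\<lambda>\<omega>. (h \<omega>, noise j \<omega>)) -` (A \<times> B) \<inter> space symbol_space = {\<omega> \<in> space M. h \<omega> \<in> A \<and> noise j \<omega> \<in> B}"
      by auto
    then show "emeasure symbol_space ((\<lambda>\<omega>. (h \<omega>, noise j \<omega>)) -` (A \<times> B) \<inter> space symbol_space) =
        emeasure symbol_space {\<omega> \<in> space M. h \<omega> \<in> A \<and> noise j \<omega> \<in> B}" by (rule arg_cong)
  qed simp_all
  also have "\<dots> = ennreal (C.prob {\<omega> \<in> space M. h \<omega> \<in> A \<and> noise j \<omega> \<in> B})"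
    by (rule C.emeasure_eq_measure)
  also have "C.prob {\<omega> \<in> space M. h \<omega> \<in> A \<and> noise j \<omega> \<in> B} =
      prob (?E \<inter> {\<omega> \<in> space M. h \<omega> \<in> A \<and> noise j \<omega> \<in> B}) / prob ?E"
    using prob_symbol_pos by (intro measure_uniform_measure) (auto simp: emeasure_eq_measure)
  also have "?E \<inter> {\<omega> \<in> space M. h \<omega> \<in> A \<and> noise j \<omega> \<in> B} =
      {\<omega> \<in> space M. (h \<omega> \<in> A \<and> noise j \<omega> \<in> B) \<and> D \<omega> = k \<and> H \<omega> = j \<and> S \<omega> = s}" by auto
  also have "prob \<dots> / prob ?E = h.prob A * n.prob B"
    unfolding prob_fading_noise_symbol[OF s \<open>A \<in> sets borel\<close> \<open>B \<in> sets borel\<close>] prob_symbol[OF s] using pos MI MQ by simp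
  finally show "emeasure (distr M borel h) A * emeasure (density lborel (noise_density j)) B =
      emeasure (distr symbol_space (borel \<Otimes>\<^sub>M borel) (\<lambda>\<omega>. (h \<omega>, noise j \<omega>))) (A \<times> B)"
    by (simp add: h.emeasure_eq_measure n.emeasure_eq_measure ennreal_mult)
qed

text \<open>The conditional densities refer to the conditional law of the fading. Identifying it
  with the unconditional law gives one base measure, and one notion of null set, for all states,
  decisions and symbols.\<close>

lemma distr_fading: "distr symbol_space borel h = distr M borel h"
proof -
  interpret h: prob_space "distr M borel h" by (rule prob_space_distr) simp
  interpret n: prob_space "density lborel (noise_density j)" by (rule prob_space_noise)
  have "distr symbol_space borel h = distr (distr symbol_space (borel \<Otimes>\<^sub>M borel) (\<lambda>\<omega>. (h \<omega>, noise j \<omega>))) borel fst"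
    by (simp add: distr_distr comp_def)
  also have "\<dots> = distr (distr M borel h \<Otimes>\<^sub>M density lborel (noise_density j)) (distr M borel h) fst"
    unfolding distr_fading_noise by (simp cong: distr_cong)
  also have "\<dots> = distr M borel h"
    by (rule n.distr_pair_fst)
  finally show ?thesis .
qed

lemma AE_symbol_space: "AE \<omega> in symbol_space. \<omega> \<in> space M \<and> D \<omega> = k \<and> H \<omega> = j \<and> S \<omega> = s"
  by (rule AE_uniform_measureI) auto

text \<open>On the conditioning event the received signal is
  \<open>h \<omega> * s + noise j \<omega>\<close> with noise independent of the fading, so at
  fading \<open>g\<close> its density is the noise density translated by
  \<open>g * s\<close>.\<close>

lemma received_distributed:
  "distributed symbol_space (distr M borel h \<Otimes>\<^sub>M lborel) (\<lambda>\<omega>. (h \<omega>, received H S h N W \<omega>))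
    (\<lambda>(g, y). ennreal (noise_density j (y - g * s)))"
  unfolding distributed_def
proof (intro conjI measure_eqI)
  have recv [measurable]: "received H S h N W \<in> borel_measurable M"
    unfolding received_def[abs_def] by measurable
  show "(\<lambda>(g, y). ennreal (noise_density j (y - g * s))) \<in> borel_measurable (distr M borel h \<Otimes>\<^sub>M lborel)"
    by measurable
  show "(\<lambda>\<omega>. (h \<omega>, received H S h N W \<omega>)) \<in> measurable symbol_space (distr M borel h \<Otimes>\<^sub>M lborel)"
    by measurable
  interpret n: prob_space "density lborel (noise_density j)" by (rule prob_space_noise)
  fix X assume "X \<in> sets (distr symbol_space (distr M borel h \<Otimes>\<^sub>M lborel) (\<lambda>\<omega>. (h \<omega>, received H S h N W \<omega>)))"
  then have X: "X \<in> sets (distr M borel h \<Otimes>\<^sub>M lborel)" by simp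
  also have "sets (distr M borel h \<Otimes>\<^sub>M lborel) = sets (borel \<Otimes>\<^sub>M borel)" by (simp cong: sets_pair_measure_cong)
  finally have [measurable]: "X \<in> sets (borel \<Otimes>\<^sub>M borel)" .
  have "emeasure (distr symbol_space (distr M borel h \<Otimes>\<^sub>M lborel) (\<lambda>\<omega>. (h \<omega>, received H S h N W \<omega>))) X =
      (\<integral>\<^sup>+x. indicator X x \<partial>distr symbol_space (distr M borel h \<Otimes>\<^sub>M lborel) (\<lambda>\<omega>. (h \<omega>, received H S h N W \<omega>)))"
    using X by (intro nn_integral_indicator[symmetric]) simp
  also have "\<dots> = (\<integral>\<^sup>+\<omega>. indicator X (h \<omega>, received H S h N W \<omega>) \<partial>symbol_space)"
    by (rule nn_integral_distr) (use X in measurable)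
  also have "\<dots> = (\<integral>\<^sup>+\<omega>. indicator X (h \<omega>, h \<omega> * s + noise j \<omega>) \<partial>symbol_space)"
  proof (rule nn_integral_cong_AE)
    show "AE \<omega> in symbol_space. indicator X (h \<omega>, received H S h N W \<omega>) = (indicator X (h \<omega>, h \<omega> * s + noise j \<omega>) :: ennreal)"
      using AE_symbol_space by eventually_elim (auto simp: received_def noise_def add.assoc)
  qed
  also have "\<dots> = (\<integral>\<^sup>+x. indicator X (fst x, fst x * s + snd x) \<partial>distr symbol_space (borel \<Otimes>\<^sub>M borel) (\<lambda>\<omega>. (h \<omega>, noise j \<omega>)))"
    by (subst nn_integral_distr) simp_all
  also have "\<dots> = (\<integral>\<^sup>+g. (\<integral>\<^sup>+z. indicator X (g, g * s + z) \<partial>density lborel (noise_density j)) \<partial>distr M borel h)"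
    unfolding distr_fading_noise by (subst n.nn_integral_fst[symmetric]) simp_all
  also have "\<dots> = (\<integral>\<^sup>+g. (\<integral>\<^sup>+y. ennreal (noise_density j (y - g * s)) * indicator X (g, y) \<partial>lborel) \<partial>distr M borel h)"
  proof (rule nn_integral_cong)
    fix g
    \<comment> \<open>Writing the noise as \<open>g * s + z - g * s\<close> makes the integrand a
      function of the received value \<open>g * s + z\<close>, ready for translation.\<close>
    have "(\<integral>\<^sup>+z. indicator X (g, g * s + z) \<partial>density lborel (noise_density j)) =
        (\<integral>\<^sup>+z. ennreal (noise_density j (g * s + z - g * s)) * indicator X (g, g * s + z) \<partial>lborel)"
      by (simp add: nn_integral_density)
    also have "\<dots> = (\<integral>\<^sup>+y. ennreal (noise_density j (y - g * s)) * indicator X (g, y) \<partial>lborel)"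
      by (rule nn_integral_lborel_translate) simp
    finally show "(\<integral>\<^sup>+z. indicator X (g, g * s + z) \<partial>density lborel (noise_density j)) =
        (\<integral>\<^sup>+y. ennreal (noise_density j (y - g * s)) * indicator X (g, y) \<partial>lborel)" .
  qed
  also have "\<dots> = (\<integral>\<^sup>+x. ennreal (noise_density j (snd x - fst x * s)) * indicator X x \<partial>(distr M borel h \<Otimes>\<^sub>M lborel))"
    by (subst lborel.nn_integral_fst[symmetric]) simp_all
  also have "\<dots> = emeasure (density (distr M borel h \<Otimes>\<^sub>M lborel) (\<lambda>(g, y). ennreal (noise_density j (y - g * s)))) X"
    using X by (subst emeasure_density) (auto simp: case_prod_beta)
  finally show "emeasure (distr symbol_space (distr M borel h \<Otimes>\<^sub>M lborel) (\<lambda>\<omega>. (h \<omega>, received H S h N W \<omega>))) X =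
      emeasure (density (distr M borel h \<Otimes>\<^sub>M lborel) (\<lambda>(g, y). ennreal (noise_density j (y - g * s)))) X" .
qed simp

text \<open>Two densities of the same law agree almost everywhere, so every admissible
  \<open>f\<close> is the translated noise density there.\<close>

lemma cond_density_AE:
  assumes f: "is_received_cond_density M MI MQ P H D S h N W f"
  shows "AE x in distr M borel h \<Otimes>\<^sub>M lborel. f k j s (fst x) (snd x) = noise_density j (snd x - fst x * s)"
proof -
  interpret C: prob_space symbol_space by (rule prob_space_symbol_space)
  have "distributed symbol_space (distr M borel h \<Otimes>\<^sub>M lborel) (\<lambda>\<omega>. (h \<omega>, received H S h N W \<omega>))
      (\<lambda>(g, y). ennreal (f k j s g y))"
    using f j k s prob_symbol_pos unfolding is_received_cond_density_def Let_def distr_fading[symmetric] by blast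
  from C.distributed_unique[OF this received_distributed]
  show ?thesis
  proof eventually_elim
    case (elim x)
    \<comment> \<open>\<open>ennreal\<close> identifies all negative values of \<open>f\<close> with
      0; the equality descends to reals because the other side is positive.\<close>
    have "0 < noise_density j (snd x - fst x * s)" by (rule gauss_mix_pos[OF mix])
    moreover have "ennreal (f k j s (fst x) (snd x)) = ennreal (noise_density j (snd x - fst x * s))"
      using elim by (simp add: case_prod_beta)
    ultimately show ?case by (metis ennreal_eq_0_iff ennreal_inj linorder_not_le nle_le order_less_le)
  qed
qed

end
end
end

section \<open>Error probability of the detector\<close>

text \<open>By \<open>2 * MI * MQ \<le> MI^2 + MQ^2\<close> the sum of squares is at least 4, so the
  denominator in the spacing is at least 2.\<close>

lemma qam_dmin_pos:
  assumes "1 \<le> MI" "1 \<le> MQ" "2 \<le> MI * MQ" "0 < Pk"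
  shows "0 < (real MI)\<^sup>2 + (real MQ)\<^sup>2 - 2" "0 < qam_dmin MI MQ Pk"
proof -
  have "2 * (real MI * real MQ) \<le> (real MI)\<^sup>2 + (real MQ)\<^sup>2"
    using sum_squares_bound[of "real MI" "real MQ"] by simp
  moreover have "2 \<le> real MI * real MQ"
    using assms(3) by (simp only: of_nat_mult[symmetric])
  ultimately show *: "0 < (real MI)\<^sup>2 + (real MQ)\<^sup>2 - 2" by linarith
  then show "0 < qam_dmin MI MQ Pk" using assms(4) by (simp add: qam_dmin_def)
qed

text \<open>Halving the spacing turns the factor 12 of its square into 3, so that
  \<open>c^2 = 3 * Pk / ((MI^2 + MQ^2 - 2) * v)\<close>.\<close>

lemma qam_beta_eq:
  assumes "1 \<le> MI" "1 \<le> MQ" "2 \<le> MI * MQ" "0 < Pk" "0 < v"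
  shows "qam_beta MI MQ Pk v = sqrt (1 + 2 / (qam_dmin MI MQ Pk / 2 / sqrt v)\<^sup>2)"
  using qam_dmin_pos[OF assms(1-4)] assms(4,5)
  by (simp add: qam_beta_def qam_dmin_def power_divide field_simps)

lemma qam_constellation_eq:
  "qam_constellation MI MQ Pk = (\<lambda>(n, q). qam_point MI MQ (qam_dmin MI MQ Pk) n q) ` ({..<MI} \<times> {..<MQ})"
  by (auto simp: qam_constellation_def qam_point_def)

text \<open>The pairs consist of fading and noise, not of fading and received signal: their law is a
  product, the same for every symbol.\<close>

definition cell_region :: "real set \<Rightarrow> real set \<Rightarrow> (complex \<times> complex) set" where
  "cell_region I J = {x. Re (snd x / fst x) \<in> I \<and> Im (snd x / fst x) \<in> J}"

lemma cell_region_measurable [measurable]: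
  assumes [measurable]: "I \<in> sets borel" "J \<in> sets borel"
  shows "cell_region I J \<in> sets (borel \<Otimes>\<^sub>M borel)"
proof -
  have "{x \<in> space (borel \<Otimes>\<^sub>M borel). Re (snd x / fst x) \<in> I \<and> Im (snd x / fst x) \<in> J} \<in> sets (borel \<Otimes>\<^sub>M borel :: (complex \<times> complex) measure)"
    by measurable
  then show ?thesis by (simp add: cell_region_def space_pair_measure)
qed

context sss_qam_rayleigh
begin

text \<open>A law with a density gives the point 0 no mass; this licenses the division by the fading
  coefficient.\<close>

lemma fading_nonzero: "AE \<omega> in M. h \<omega> \<noteq> 0"
proof -
  have "emeasure M ((\<lambda>\<omega>. (cmod (h \<omega>))\<^sup>2) -` {0} \<inter> space M) =
      (\<integral>\<^sup>+x. ennreal (if 0 \<le> x then exp (- x) else 0) * indicator {0} x \<partial>lborel)"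
    by (rule distributed_emeasure[OF rayleigh]) simp
  also have "\<dots> = 0"
    by (subst nn_integral_0_iff_AE) (auto intro: AE_mp[OF AE_lborel_singleton[of 0]])
  finally have "emeasure M ((\<lambda>\<omega>. (cmod (h \<omega>))\<^sup>2) -` {0} \<inter> space M) = 0" .
  then show ?thesis
    by (intro AE_I[where N = "(\<lambda>\<omega>. (cmod (h \<omega>))\<^sup>2) -` {0} \<inter> space M"]) auto
qed

abbreviation spacing :: "nat \<Rightarrow> real" where "spacing k \<equiv> qam_dmin MI MQ (P k)"

abbreviation symbol :: "nat \<Rightarrow> nat \<Rightarrow> nat \<Rightarrow> complex" where "symbol k \<equiv> qam_point MI MQ (spacing k)"

definition cell_tail :: "nat \<Rightarrow> nat \<Rightarrow> nat \<Rightarrow> 'a \<Rightarrow> real" where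
  "cell_tail j k l \<omega> = gauss_tail (spacing k / 2 / sqrt (mix_var j l) * cmod (h \<omega>))"

lemma measurable_cell_tail [measurable]: "cell_tail j k l \<in> borel_measurable M"
  unfolding cell_tail_def by measurable

lemma spacing_pos: "k \<in> {0,1} \<Longrightarrow> 0 < spacing k"
  using MI MQ M_ge_2 power_pos by (intro qam_dmin_pos) auto

lemma cell_tail_bounds:
  assumes "k \<in> {0,1}" "l \<in> mix_index j"
  shows "0 \<le> cell_tail j k l \<omega>" "cell_tail j k l \<omega> \<le> 1 / 2"
  using spacing_pos[OF assms(1)] mix(4)[OF assms(2)]
  unfolding cell_tail_def by (simp_all only: gauss_tail_nonneg) (intro gauss_tail_le_half, simp)

lemma cell_prob_integrable:
  assumes "k \<in> {0,1}" "l \<in> mix_index j"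
  shows "integrable M (\<lambda>\<omega>. cell_prob m n (cell_tail j k l \<omega>) * cell_prob m' n' (cell_tail j k l \<omega>))"
proof (rule integrable_const_bound[of _ 1])
  have "cell_prob m n (cell_tail j k l \<omega>) \<in> {0..1}" for m n \<omega>
    using cell_tail_bounds[OF assms, of \<omega>] by (auto simp: cell_prob_def of_bool_def)
  then show "AE \<omega> in M. norm (cell_prob m n (cell_tail j k l \<omega>) * cell_prob m' n' (cell_tail j k l \<omega>)) \<le> 1"
    by (auto simp: abs_mult intro!: mult_le_one)
  show "(\<lambda>\<omega>. cell_prob m n (cell_tail j k l \<omega>) * cell_prob m' n' (cell_tail j k l \<omega>)) \<in> borel_measurable M"
    unfolding cell_prob_def by measurable
qed

text \<open>In the product measure the noise is integrated first, at a fixed nonzero fading value,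
  where the mixture formula applies; what remains is an expectation over the fading.\<close>

lemma emeasure_cell_region:
  assumes k: "k \<in> {0,1}" and [measurable]: "I \<in> sets borel" "J \<in> sets borel"
    and I: "open_cell MI (spacing k / 2) n \<subseteq> I" "I \<subseteq> closed_cell MI (spacing k / 2) n"
    and J: "open_cell MQ (spacing k / 2) q \<subseteq> J" "J \<subseteq> closed_cell MQ (spacing k / 2) q"
    and ps: "prob_space (density lborel (noise_density j))"
  shows "emeasure (distr M borel h \<Otimes>\<^sub>M density lborel (noise_density j)) (cell_region I J) =
    ennreal (\<Sum>l\<in>mix_index j. mix_weight j l * expectation (\<lambda>\<omega>. cell_prob MI n (cell_tail j k l \<omega>) * cell_prob MQ q (cell_tail j k l \<omega>)))"
proof -
  interpret n: prob_space "density lborel (noise_density j)" by (rule ps)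
  let ?F = "\<lambda>\<omega>. \<Sum>l\<in>mix_index j. mix_weight j l * (cell_prob MI n (cell_tail j k l \<omega>) * cell_prob MQ q (cell_tail j k l \<omega>))"
  have a: "0 < spacing k / 2" using spacing_pos[OF k] by simp
  have sets: "cell_region I J \<in> sets (distr M borel h \<Otimes>\<^sub>M density lborel (noise_density j))"
    by (simp cong: sets_pair_measure_cong)
  have [measurable]: "(\<lambda>x. indicator (cell_region I J) x :: ennreal) \<in> borel_measurable (distr M borel h \<Otimes>\<^sub>M density lborel (noise_density j))"
    using sets by measurable
  have "emeasure (distr M borel h \<Otimes>\<^sub>M density lborel (noise_density j)) (cell_region I J) =
      (\<integral>\<^sup>+g. (\<integral>\<^sup>+z. indicator (cell_region I J) (g, z) \<partial>density lborel (noise_density j)) \<partial>distr M borel h)"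
    by (rule n.emeasure_pair_measure[OF sets])
  also have "\<dots> = (\<integral>\<^sup>+\<omega>. (\<integral>\<^sup>+z. indicator (cell_region I J) (h \<omega>, z) \<partial>density lborel (noise_density j)) \<partial>M)"
    by (rule nn_integral_distr) measurable
  also have "\<dots> = (\<integral>\<^sup>+\<omega>. ennreal (?F \<omega>) \<partial>M)"
  proof (rule nn_integral_cong_AE)
    show "AE \<omega> in M. (\<integral>\<^sup>+z. indicator (cell_region I J) (h \<omega>, z) \<partial>density lborel (noise_density j)) = ennreal (?F \<omega>)"
      using fading_nonzero
    proof eventually_elim
      case (elim \<omega>)
      have "(\<integral>\<^sup>+z. indicator (cell_region I J) (h \<omega>, z) \<partial>density lborel (noise_density j)) =
          (\<integral>\<^sup>+z. ennreal (noise_density j z) * indicator (cell_region I J) (h \<omega>, z) \<partial>lborel)"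
        by (rule nn_integral_density) measurable
      also have "\<dots> = (\<integral>\<^sup>+z. ennreal (noise_density j z) * (indicator I (Re (z / h \<omega>)) * indicator J (Im (z / h \<omega>))) \<partial>lborel)"
        by (intro nn_integral_cong) (auto simp: cell_region_def indicator_def)
      also have "\<dots> = ennreal (?F \<omega>)"
        unfolding cell_tail_def
        by (rule nn_integral_gauss_mix_cell[OF mix elim a _ _ I J]) simp_all
      finally show ?case .
    qed
  qed
  also have "\<dots> = ennreal (expectation ?F)"
  proof (rule nn_integral_eq_integral)
    show "integrable M ?F" using cell_prob_integrable[OF k] by simp
    have "0 \<le> ?F \<omega>" for \<omega>
      using mix(2) cell_tail_bounds[OF k] by (intro sum_nonneg mult_nonneg_nonneg cell_prob_nonneg) auto
    then show "AE \<omega> in M. 0 \<le> ?F \<omega>" by simp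
  qed
  also have "expectation ?F = (\<Sum>l\<in>mix_index j. mix_weight j l * expectation (\<lambda>\<omega>. cell_prob MI n (cell_tail j k l \<omega>) * cell_prob MQ q (cell_tail j k l \<omega>)))"
    using cell_prob_integrable[OF k] by (subst Bochner_Integration.integral_sum) simp_all
  finally show ?thesis .
qed

lemma posterior_eq:
  assumes "j \<in> {0,1}" "k \<in> {0,1}"
  shows "posterior prior Pd Pf j k = prob {\<omega> \<in> space M. H \<omega> = j \<and> D \<omega> = k} / decision_prob prior Pd Pf k"
  using state_decision[OF assms] by (simp add: posterior_def)

lemma posterior_nonneg: "j \<in> {0,1} \<Longrightarrow> k \<in> {0,1} \<Longrightarrow> 0 \<le> posterior prior Pd Pf j k"
  using decision_prob_pos[of k] by (simp add: posterior_eq)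

lemma posterior_sum: "k \<in> {0,1} \<Longrightarrow> posterior prior Pd Pf 0 k + posterior prior Pd Pf 1 k = 1"
  using decision_prob_pos[of k] by (simp add: posterior_def decision_prob_def add_divide_distrib[symmetric])

text \<open>Both noise densities decrease with the distance from the origin, and so does their posterior
  average. Hence the detector decides for the nearest point, whatever the posterior is.\<close>

lemma detector_nearest:
  assumes f: "is_received_cond_density M MI MQ P H D S h N W f"
    and det: "is_map_detector prior Pd Pf MI MQ P f detector" and k: "k \<in> {0,1}"
  shows "AE x in distr M borel h \<Otimes>\<^sub>M lborel. detector k (fst x) (snd x) \<in> qam_constellation MI MQ (P k) \<and>
    (\<forall>s\<in>qam_constellation MI MQ (P k). cmod (snd x - fst x * detector k (fst x) (snd x)) \<le> cmod (snd x - fst x * s))"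
proof -
  let ?C = "qam_constellation MI MQ (P k)" and ?p = "\<lambda>j. posterior prior Pd Pf j k"
  let ?R = "\<lambda>z. ?p 0 * noise_density 0 z + ?p 1 * noise_density 1 z"
  have R: "?R z' < ?R z" if "cmod z < cmod z'" for z z'
  proof -
    have less: "noise_density j z' < noise_density j z" for j
      by (rule gauss_mix_strict_antimono[OF mix that])
    have p: "0 \<le> ?p 0" "0 \<le> ?p 1" using k by (simp_all add: posterior_nonneg)
    have "?p 0 * noise_density 0 z' \<le> ?p 0 * noise_density 0 z" "?p 1 * noise_density 1 z' \<le> ?p 1 * noise_density 1 z"
      using p less by (simp_all add: mult_left_mono less_imp_le)
    \<comment> \<open>The posteriors sum to 1, so one of them is positive and keeps its inequality
      strict.\<close>
    moreover have "?p 0 * noise_density 0 z' < ?p 0 * noise_density 0 z \<or> ?p 1 * noise_density 1 z' < ?p 1 * noise_density 1 z"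
      using posterior_sum[OF k] p less by (cases "?p 0 = 0") (auto intro: mult_strict_left_mono)
    ultimately show ?thesis by linarith
  qed
  have fin: "finite ?C" by (simp add: qam_constellation_eq)
  \<comment> \<open>Nothing is known about \<open>f k j\<close> if the pair has probability zero,
    but then the posterior is 0. Hence the densities are compared only after weighting.\<close>
  have weighted: "AE x in distr M borel h \<Otimes>\<^sub>M lborel. ?p j * f k j s (fst x) (snd x) = ?p j * noise_density j (snd x - fst x * s)"
    if "s \<in> ?C" "j \<in> {0,1}" for s j
  proof (cases "prob {\<omega> \<in> space M. H \<omega> = j \<and> D \<omega> = k} > 0")
    case True
    show ?thesis
      using cond_density_AE[OF that(2) k True that(1) f] by eventually_elim simp
  next
    case False
    then have "prob {\<omega> \<in> space M. H \<omega> = j \<and> D \<omega> = k} = 0" using measure_nonneg[of M] by (simp add: not_less antisym)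
    then show ?thesis using that k by (simp add: posterior_eq)
  qed
  have "AE x in distr M borel h \<Otimes>\<^sub>M lborel. \<forall>s\<in>?C. ?p 0 * f k 0 s (fst x) (snd x) + ?p 1 * f k 1 s (fst x) (snd x) = ?R (snd x - fst x * s)"
    \<comment> \<open>The null sets of the finitely many constellation points can be united.\<close>
    unfolding AE_finite_all[OF fin]
  proof
    fix s assume s: "s \<in> ?C"
    show "AE x in distr M borel h \<Otimes>\<^sub>M lborel. ?p 0 * f k 0 s (fst x) (snd x) + ?p 1 * f k 1 s (fst x) (snd x) = ?R (snd x - fst x * s)"
      using weighted[OF s insertI1] weighted[OF s insertI2[OF singletonI]] by eventually_elim (simp only:)
  qed
  then show ?thesis
  proof eventually_elim
    case (elim x)
    have am: "is_arg_max (\<lambda>s. ?p 0 * f k 0 s (fst x) (snd x) + ?p 1 * f k 1 s (fst x) (snd x)) (\<lambda>s. s \<in> ?C) (detector k (fst x) (snd x))"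
      using det k unfolding is_map_detector_def by blast
    then have C: "detector k (fst x) (snd x) \<in> ?C" by (simp add: is_arg_max_def)
    moreover have "cmod (snd x - fst x * detector k (fst x) (snd x)) \<le> cmod (snd x - fst x * s)" if s: "s \<in> ?C" for s
    proof (rule ccontr)
      assume "\<not> ?thesis"
      then have "?R (snd x - fst x * detector k (fst x) (snd x)) < ?R (snd x - fst x * s)" by (intro R) simp
      then show False using am s elim C unfolding is_arg_max_def by simp
    qed
    ultimately show ?case by blast
  qed
qed

section \<open>From correct decisions to the error probability\<close>

context
  fixes f :: "nat \<Rightarrow> nat \<Rightarrow> complex \<Rightarrow> complex \<Rightarrow> complex \<Rightarrow> real"
    and detector :: "nat \<Rightarrow> complex \<Rightarrow> complex \<Rightarrow> complex"
  assumes f: "is_received_cond_density M MI MQ P H D S h N W f"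
    and det: "is_map_detector prior Pd Pf MI MQ P f detector"
    and out [measurable]: "(\<lambda>\<omega>. detector (D \<omega>) (h \<omega>) (received H S h N W \<omega>)) \<in> borel_measurable M"
begin

abbreviation decoded :: "'a \<Rightarrow> complex" where
  "decoded \<omega> \<equiv> detector (D \<omega>) (h \<omega>) (received H S h N W \<omega>)"

lemma correct_event [measurable]: "{\<omega> \<in> space M. decoded \<omega> = S \<omega>} \<in> events"
proof -
  have "{\<omega> \<in> space M. decoded \<omega> = S \<omega>} = (\<lambda>\<omega>. decoded \<omega> - S \<omega>) -` {0} \<inter> space M" by auto
  also have "\<dots> \<in> events" by measurable
  finally show ?thesis .
qed

text \<open>The event of a correct decision need not be described by a rectangle, since its boundary
  depends on how ties are broken. Given the symbol, it almost surely contains the open and is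
  contained in the closed region, and both have probability \<open>?V\<close>.\<close>

lemma prob_correct_symbol:
  assumes j: "j \<in> {0,1}" and k: "k \<in> {0,1}" and pos: "prob {\<omega> \<in> space M. H \<omega> = j \<and> D \<omega> = k} > 0"
    and n: "n < MI" and q: "q < MQ"
  shows "prob ({\<omega> \<in> space M. decoded \<omega> = S \<omega>} \<inter> {\<omega> \<in> space M. D \<omega> = k \<and> H \<omega> = j \<and> S \<omega> = symbol k n q}) =
    prob {\<omega> \<in> space M. H \<omega> = j \<and> D \<omega> = k} / (real MI * real MQ) *
    (\<Sum>l\<in>mix_index j. mix_weight j l * expectation (\<lambda>\<omega>. cell_prob MI n (cell_tail j k l \<omega>) * cell_prob MQ q (cell_tail j k l \<omega>)))"
    (is "_ = _ * ?V")
proof -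
  let ?s = "symbol k n q" and ?a = "spacing k / 2"
  let ?E = "{\<omega> \<in> space M. D \<omega> = k \<and> H \<omega> = j \<and> S \<omega> = ?s}"
  have s: "?s \<in> qam_constellation MI MQ (P k)" using n q by (auto simp: qam_constellation_eq)
  let ?C = "uniform_measure M ?E"
  interpret C: prob_space ?C by (rule prob_space_symbol_space[OF j k pos s])
  have region: "C.prob {\<omega> \<in> space M. (h \<omega>, noise j \<omega>) \<in> cell_region I J} = ?V"
    if [measurable]: "I \<in> sets borel" "J \<in> sets borel"
      and IJ: "open_cell MI ?a n \<subseteq> I" "I \<subseteq> closed_cell MI ?a n" "open_cell MQ ?a q \<subseteq> J" "J \<subseteq> closed_cell MQ ?a q" for I J
  proof -
    have "emeasure ?C {\<omega> \<in> space M. (h \<omega>, noise j \<omega>) \<in> cell_region I J} =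
        emeasure (distr ?C (borel \<Otimes>\<^sub>M borel) (\<lambda>\<omega>. (h \<omega>, noise j \<omega>))) (cell_region I J)"
    proof (subst emeasure_distr)
      have "(\<lambda>\<omega>. (h \<omega>, noise j \<omega>)) -` cell_region I J \<inter> space ?C = {\<omega> \<in> space M. (h \<omega>, noise j \<omega>) \<in> cell_region I J}" by auto
      then show "emeasure ?C {\<omega> \<in> space M. (h \<omega>, noise j \<omega>) \<in> cell_region I J} =
          emeasure ?C ((\<lambda>\<omega>. (h \<omega>, noise j \<omega>)) -` cell_region I J \<inter> space ?C)" by (rule arg_cong[symmetric])
    qed simp_all
    also have "\<dots> = ennreal ?V"
      unfolding distr_fading_noise[OF j k pos s]
      by (rule emeasure_cell_region[OF k that prob_space_noise[OF j k pos]])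
    finally have "emeasure ?C {\<omega> \<in> space M. (h \<omega>, noise j \<omega>) \<in> cell_region I J} = ennreal ?V" .
    moreover have "0 \<le> ?V"
      using mix(2) cell_tail_bounds[OF k]
      by (intro sum_nonneg mult_nonneg_nonneg Bochner_Integration.integral_nonneg cell_prob_nonneg) auto
    ultimately show ?thesis by (simp add: measure_def)
  qed
  \<comment> \<open>The nearest-point property holds almost everywhere for the law of the fading
    times Lebesgue measure. The law of fading and received signal has a density there, so the
    property holds almost surely in \<open>?C\<close>.\<close>
  have "AE x in distr ?C (distr M borel h \<Otimes>\<^sub>M lborel) (\<lambda>\<omega>. (h \<omega>, received H S h N W \<omega>)).
      \<forall>s\<in>qam_constellation MI MQ (P k). cmod (snd x - fst x * detector k (fst x) (snd x)) \<le> cmod (snd x - fst x * s)"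
    and "AE x in distr ?C (distr M borel h \<Otimes>\<^sub>M lborel) (\<lambda>\<omega>. (h \<omega>, received H S h N W \<omega>)).
      detector k (fst x) (snd x) \<in> qam_constellation MI MQ (P k)"
    unfolding distributed_distr_eq_density[OF received_distributed[OF j k pos s]]
      AE_density[OF distributed_borel_measurable[OF received_distributed[OF j k pos s]]]
    using detector_nearest[OF f det k] by auto
  note nearest = this[THEN AE_distrD[OF distributed_measurable[OF received_distributed[OF j k pos s]]], simplified]
  have "AE \<omega> in M. \<omega> \<in> ?E \<longrightarrow> h \<omega> \<noteq> 0" using fading_nonzero by auto
  then have h0: "AE \<omega> in ?C. h \<omega> \<noteq> 0" by (intro AE_uniform_measureI) simp_all
  note AE = nearest h0 AE_symbol_space[OF j k pos s]
  have received: "received H S h N W \<omega> = h \<omega> * ?s + noise j \<omega>" if "H \<omega> = j" "S \<omega> = ?s" for \<omega>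
    using that by (auto simp: received_def noise_def add.assoc)
  have lower: "AE \<omega> in ?C. \<omega> \<in> {\<omega> \<in> space M. (h \<omega>, noise j \<omega>) \<in> cell_region (open_cell MI ?a n) (open_cell MQ ?a q)}
      \<longrightarrow> \<omega> \<in> {\<omega> \<in> space M. decoded \<omega> = S \<omega>}"
    using AE
  proof eventually_elim
    case (elim \<omega>)
    have "detector k (h \<omega>) (received H S h N W \<omega>) = ?s"
      if "(h \<omega>, noise j \<omega>) \<in> cell_region (open_cell MI ?a n) (open_cell MQ ?a q)"
    proof (rule ccontr)
      assume ne: "detector k (h \<omega>) (received H S h N W \<omega>) \<noteq> ?s"
      obtain n' q' where nq: "n' < MI" "q' < MQ" "detector k (h \<omega>) (received H S h N W \<omega>) = symbol k n' q'"
        using elim(2) by (auto simp: qam_constellation_eq)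
      then have "(n', q') \<noteq> (n, q)" using ne by auto
      from nearest_qam_point_if_open_cell[OF spacing_pos[OF k] elim(3) _ _ nq(1,2) this, of "noise j \<omega>"] that
      have "cmod (h \<omega> * ?s + noise j \<omega> - h \<omega> * ?s) < cmod (h \<omega> * ?s + noise j \<omega> - h \<omega> * symbol k n' q')"
        by (simp add: cell_region_def)
      moreover have "cmod (h \<omega> * ?s + noise j \<omega> - h \<omega> * symbol k n' q') \<le> cmod (h \<omega> * ?s + noise j \<omega> - h \<omega> * ?s)"
        using bspec[OF elim(1) s] elim(4) received[of \<omega>] nq(3) by simp
      ultimately show False by simp
    qed
    then show ?case using elim(4) by auto
  qed
  have upper: "AE \<omega> in ?C. \<omega> \<in> {\<omega> \<in> space M. decoded \<omega> = S \<omega>}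
      \<longrightarrow> \<omega> \<in> {\<omega> \<in> space M. (h \<omega>, noise j \<omega>) \<in> cell_region (closed_cell MI ?a n) (closed_cell MQ ?a q)}"
    using AE
  proof eventually_elim
    case (elim \<omega>)
    have "(h \<omega>, noise j \<omega>) \<in> cell_region (closed_cell MI ?a n) (closed_cell MQ ?a q)" if "decoded \<omega> = S \<omega>"
    proof -
      have d: "detector k (h \<omega>) (h \<omega> * ?s + noise j \<omega>) = ?s" using that elim(4) received[of \<omega>] by simp
      have le: "cmod (h \<omega> * ?s + noise j \<omega> - h \<omega> * ?s) \<le> cmod (h \<omega> * ?s + noise j \<omega> - h \<omega> * symbol k n' q')"
        if "n' < MI" "q' < MQ" for n' q'
      proof -
        have "symbol k n' q' \<in> qam_constellation MI MQ (P k)" using that by (auto simp: qam_constellation_eq)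
        from bspec[OF elim(1) this] show ?thesis using elim(4) received[of \<omega>] d by simp
      qed
      show ?thesis
        using closed_cell_if_nearest_qam_point[OF spacing_pos[OF k] elim(3) n q le]
        by (simp add: cell_region_def)
    qed
    then show ?case by auto
  qed
  have sub: "open_cell MI ?a n \<subseteq> closed_cell MI ?a n" "open_cell MQ ?a q \<subseteq> closed_cell MQ ?a q"
    by (rule open_cell_subset_closed_cell)+
  have reg_meas: "{\<omega> \<in> space M. (h \<omega>, noise j \<omega>) \<in> cell_region I J} \<in> sets ?C"
    if [measurable]: "I \<in> sets borel" "J \<in> sets borel" for I J
    by measurable
  have "C.prob {\<omega> \<in> space M. (h \<omega>, noise j \<omega>) \<in> cell_region (open_cell MI ?a n) (open_cell MQ ?a q)} \<le> C.prob {\<omega> \<in> space M. decoded \<omega> = S \<omega>}"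
    by (rule C.finite_measure_mono_AE[OF lower]) simp
  moreover have "C.prob {\<omega> \<in> space M. decoded \<omega> = S \<omega>} \<le> C.prob {\<omega> \<in> space M. (h \<omega>, noise j \<omega>) \<in> cell_region (closed_cell MI ?a n) (closed_cell MQ ?a q)}"
    by (rule C.finite_measure_mono_AE[OF upper]) (rule reg_meas; simp)
  ultimately have "C.prob {\<omega> \<in> space M. decoded \<omega> = S \<omega>} = ?V"
    using sub by (simp add: region)
  moreover have "C.prob {\<omega> \<in> space M. decoded \<omega> = S \<omega>} = prob (?E \<inter> {\<omega> \<in> space M. decoded \<omega> = S \<omega>}) / prob ?E"
    using prob_symbol_pos[OF j k pos s] by (intro measure_uniform_measure) (auto simp: emeasure_eq_measure)
  ultimately show ?thesis
    using prob_symbol_pos[OF j k pos s]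
    by (simp add: prob_symbol[OF j k pos s, symmetric] Int_commute field_simps)
qed

lemma prob_error_state_decision:
  assumes j: "j \<in> {0,1}" and k: "k \<in> {0,1}"
  shows "prob {\<omega> \<in> space M. decoded \<omega> \<noteq> S \<omega> \<and> H \<omega> = j \<and> D \<omega> = k} =
    prob {\<omega> \<in> space M. H \<omega> = j \<and> D \<omega> = k} *
    (\<Sum>l\<in>mix_index j. mix_weight j l * qam_error MI MQ (qam_beta MI MQ (P k) (mix_var j l)))"
proof -
  let ?F = "{\<omega> \<in> space M. H \<omega> = j \<and> D \<omega> = k}" and ?G = "{\<omega> \<in> space M. decoded \<omega> = S \<omega>}"
  let ?E = "\<lambda>(n, q). {\<omega> \<in> space M. D \<omega> = k \<and> H \<omega> = j \<and> S \<omega> = symbol k n q}"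
  let ?I = "{..<MI} \<times> {..<MQ}"
  have err: "{\<omega> \<in> space M. decoded \<omega> \<noteq> S \<omega> \<and> H \<omega> = j \<and> D \<omega> = k} = ?F - ?G" by auto
  show ?thesis
  proof (cases "prob ?F > 0")
    \<comment> \<open>Conditioning is impossible here, but both sides vanish.\<close>
    case False
    then have "prob ?F = 0" using measure_nonneg[of M ?F] by (simp add: not_less antisym)
    moreover have "prob (?F - ?G) \<le> prob ?F" by (intro finite_measure_mono) auto
    ultimately show ?thesis unfolding err using measure_nonneg[of M "?F - ?G"] by simp
  next
    case True
    let ?V = "\<lambda>n q. \<Sum>l\<in>mix_index j. mix_weight j l * expectation (\<lambda>\<omega>. cell_prob MI n (cell_tail j k l \<omega>) * cell_prob MQ q (cell_tail j k l \<omega>))"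
    have E: "?E x \<in> events" for x by (cases x) simp
    have disj: "disjoint_family_on ?E ?I"
      using spacing_pos[OF k] by (auto simp: disjoint_family_on_def qam_point_inject)
    have disj': "disjoint_family_on (\<lambda>x. ?G \<inter> ?E x) ?I"
      using disj unfolding disjoint_family_on_def by blast
    have "prob (\<Union>x\<in>?I. ?E x) = (\<Sum>x\<in>?I. prob (?E x))"
      using E by (intro finite_measure_finite_Union disj) auto
    also have "\<dots> = (\<Sum>x\<in>?I. prob ?F / (real MI * real MQ))"
    proof (intro sum.cong refl)
      fix x assume "x \<in> ?I"
      then show "prob (?E x) = prob ?F / (real MI * real MQ)"
        by (cases x) (auto intro!: prob_symbol[OF j k True] simp: qam_constellation_eq)
    qed
    also have "\<dots> = prob ?F" using MI MQ by simp
    finally have union: "prob (\<Union>x\<in>?I. ?E x) = prob ?F" .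
    \<comment> \<open>The model fixes only the probabilities of the symbol values. That the
      constellation is hit almost surely on \<open>?F\<close> follows because its
      \<open>MI * MQ\<close> equal shares add up to \<open>prob ?F\<close>.\<close>
    have "prob (?F - (\<Union>x\<in>?I. ?E x)) = prob ?F - prob (\<Union>x\<in>?I. ?E x)"
      using E by (intro finite_measure_Diff) auto
    then have null: "prob (?F - (\<Union>x\<in>?I. ?E x)) = 0" using union by simp
    have "prob (?F \<inter> ?G) = prob (\<Union>x\<in>?I. ?G \<inter> ?E x)"
    proof (rule antisym)
      have "prob (?F \<inter> ?G) \<le> prob ((\<Union>x\<in>?I. ?G \<inter> ?E x) \<union> (?F - (\<Union>x\<in>?I. ?E x)))"
        using E by (intro finite_measure_mono) auto
      also have "\<dots> \<le> prob (\<Union>x\<in>?I. ?G \<inter> ?E x) + prob (?F - (\<Union>x\<in>?I. ?E x))"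
        using E by (intro measure_Un_le) auto
      finally show "prob (?F \<inter> ?G) \<le> prob (\<Union>x\<in>?I. ?G \<inter> ?E x)" using null by simp
      show "prob (\<Union>x\<in>?I. ?G \<inter> ?E x) \<le> prob (?F \<inter> ?G)"
        by (intro finite_measure_mono) auto
    qed
    also have "\<dots> = (\<Sum>x\<in>?I. prob (?G \<inter> ?E x))"
      using E by (intro finite_measure_finite_Union disj') auto
    also have "\<dots> = (\<Sum>(n, q)\<in>?I. prob ?F / (real MI * real MQ) * ?V n q)"
    proof (intro sum.cong refl)
      fix x assume "x \<in> ?I"
      then show "prob (?G \<inter> ?E x) = (case x of (n, q) \<Rightarrow> prob ?F / (real MI * real MQ) * ?V n q)"
        using prob_correct_symbol[OF j k True] by (cases x) simp
    qed
    also have "\<dots> = prob ?F / (real MI * real MQ) * (\<Sum>n<MI. \<Sum>q<MQ. ?V n q)"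
      by (simp add: sum.cartesian_product[symmetric] sum_distrib_left)
    also have "(\<Sum>n<MI. \<Sum>q<MQ. ?V n q) = (\<Sum>l\<in>mix_index j. mix_weight j l *
        (\<Sum>n<MI. \<Sum>q<MQ. expectation (\<lambda>\<omega>. cell_prob MI n (cell_tail j k l \<omega>) * cell_prob MQ q (cell_tail j k l \<omega>))))"
      unfolding sum_distrib_left by (subst sum.swap, subst (2) sum.swap) (rule refl)
    also have "\<dots> = (\<Sum>l\<in>mix_index j. mix_weight j l * (real MI * real MQ * (1 - qam_error MI MQ (qam_beta MI MQ (P k) (mix_var j l)))))"
    proof (intro sum.cong refl arg_cong2[where f="(*)"])
      fix l assume l: "l \<in> mix_index j"
      have c: "0 < spacing k / 2 / sqrt (mix_var j l)" using spacing_pos[OF k] mix(4)[OF l] by simp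
      have b: "qam_beta MI MQ (P k) (mix_var j l) = sqrt (1 + 2 / (spacing k / 2 / sqrt (mix_var j l))\<^sup>2)"
        using MI MQ M_ge_2 power_pos[OF k] mix(4)[OF l] by (rule qam_beta_eq)
      show "(\<Sum>n<MI. \<Sum>q<MQ. expectation (\<lambda>\<omega>. cell_prob MI n (cell_tail j k l \<omega>) * cell_prob MQ q (cell_tail j k l \<omega>))) =
          real MI * real MQ * (1 - qam_error MI MQ (qam_beta MI MQ (P k) (mix_var j l)))"
        using expectation_sum_cell_prob[OF rayleigh c b MI MQ] by (simp add: cell_tail_def)
    qed
    also have "prob ?F / (real MI * real MQ) * \<dots> = prob ?F * (\<Sum>l\<in>mix_index j. mix_weight j l * (1 - qam_error MI MQ (qam_beta MI MQ (P k) (mix_var j l))))"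
      using MI MQ by (simp add: sum_distrib_left mult_ac)
    also have "\<dots> = prob ?F * (1 - (\<Sum>l\<in>mix_index j. mix_weight j l * qam_error MI MQ (qam_beta MI MQ (P k) (mix_var j l))))"
      by (simp add: right_diff_distrib sum_subtractf mix(3))
    finally have correct: "prob (?F \<inter> ?G) = \<dots>" .
    have "prob (?F - ?G) = prob ?F - prob (?F \<inter> ?G)"
      by (rule finite_measure_Diff') simp_all
    then show ?thesis unfolding err correct by (simp add: algebra_simps)
  qed
qed

text \<open>The error event is partitioned by the four pairs of decision and state, and decision
  probability times posterior is the probability of such a pair.\<close>

lemma SEP_eq:
  "SEP M H D S h N W detector = (\<Sum>k\<in>{0,1}. decision_prob prior Pd Pf k * (\<Sum>j\<in>{0,1}. posterior prior Pd Pf j k *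
    (\<Sum>l\<in>mix_index j. mix_weight j l * qam_error MI MQ (qam_beta MI MQ (P k) (mix_var j l)))))"
proof -
  let ?A = "\<lambda>(k, j). {\<omega> \<in> space M. decoded \<omega> \<noteq> S \<omega> \<and> H \<omega> = j \<and> D \<omega> = k}"
  have A: "?A x \<in> events" for x
  proof (cases x)
    case (Pair k j)
    have "?A x = {\<omega> \<in> space M. H \<omega> = j \<and> D \<omega> = k} - {\<omega> \<in> space M. decoded \<omega> = S \<omega>}" using Pair by auto
    also have "\<dots> \<in> events" by simp
    finally show ?thesis .
  qed
  have "{\<omega> \<in> space M. decoded \<omega> \<noteq> S \<omega>} = (\<Union>x\<in>{0,1} \<times> {0,1}. ?A x)"
    using measurable_space[OF H_rv] measurable_space[OF D_rv] by force
  then have "SEP M H D S h N W detector = prob (\<Union>x\<in>{0,1} \<times> {0,1}. ?A x)"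
    by (simp add: SEP_def)
  also have "\<dots> = (\<Sum>x\<in>{0,1} \<times> {0,1}. prob (?A x))"
    using A by (intro finite_measure_finite_Union) (auto simp: disjoint_family_on_def)
  also have "\<dots> = (\<Sum>k\<in>{0,1}. \<Sum>j\<in>{0,1}. prob (?A (k, j)))"
    by (subst sum.cartesian_product) (intro sum.cong refl, simp add: case_prod_beta)
  also have "\<dots> = (\<Sum>k\<in>{0,1}. decision_prob prior Pd Pf k * (\<Sum>j\<in>{0,1}. posterior prior Pd Pf j k *
    (\<Sum>l\<in>mix_index j. mix_weight j l * qam_error MI MQ (qam_beta MI MQ (P k) (mix_var j l)))))"
    unfolding sum_distrib_left
  proof (intro sum.cong refl)
    fix k j :: nat assume kj: "k \<in> {0,1}" "j \<in> {0,1}"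
    then show "prob (?A (k, j)) = (\<Sum>l\<in>mix_index j. decision_prob prior Pd Pf k * (posterior prior Pd Pf j k *
        (mix_weight j l * qam_error MI MQ (qam_beta MI MQ (P k) (mix_var j l)))))"
      using decision_prob_pos[OF kj(1)] prob_error_state_decision[OF kj(2,1)]
      by (simp add: posterior_eq sum_distrib_left mult_ac)
  qed
  finally show ?thesis .
qed

end
end

theorem mainTheorem3:
  fixes M :: "'a measure"
    and prior :: "nat \<Rightarrow> real" and Pd Pf :: real
    and MI MQ :: nat and P :: "nat \<Rightarrow> real"
    and \<sigma>n :: real and p :: nat and lam \<sigma> :: "nat \<Rightarrow> real"
    and H D :: "'a \<Rightarrow> nat"
    and S h N W :: "'a \<Rightarrow> complex"
    and f :: "nat \<Rightarrow> nat \<Rightarrow> complex \<Rightarrow> complex \<Rightarrow> complex \<Rightarrow> real"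
    and detector :: "nat \<Rightarrow> complex \<Rightarrow> complex \<Rightarrow> complex"
  defines "\<beta>0 \<equiv> \<lambda>k. qam_beta MI MQ (P k) (\<sigma>n\<^sup>2)"
    and "\<beta>1 \<equiv> \<lambda>k l. qam_beta MI MQ (P k) ((\<sigma> l)\<^sup>2 + \<sigma>n\<^sup>2)"
  assumes model: "sss_qam_rayleigh M prior Pd Pf MI MQ P \<sigma>n p lam \<sigma> H D S h N W"
    and f_density: "is_received_cond_density M MI MQ P H D S h N W f"
    and det_map: "is_map_detector prior Pd Pf MI MQ P f detector"
    and output_rv: "(\<lambda>\<omega>. detector (D \<omega>) (h \<omega>) (received H S h N W \<omega>)) \<in> borel_measurable M"
  shows "SEP M H D S h N W detector =
    (\<Sum>k\<in>{0,1}. decision_prob prior Pd Pf k *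
      (posterior prior Pd Pf 0 k *
         ((2 - 1 / real MI - 1 / real MQ) * (1 - 1 / \<beta>0 k)
          - 2 * (1 - 1 / real MI) * (1 - 1 / real MQ) *
              (2 / pi * (1 / \<beta>0 k) * arctan (1 / \<beta>0 k) - 1 / \<beta>0 k + 1 / 2))
     + posterior prior Pd Pf 1 k *
         ((2 - 1 / real MI - 1 / real MQ) * (\<Sum>l=1..p. lam l * (1 - 1 / \<beta>1 k l))
          - 2 * (1 - 1 / real MI) * (1 - 1 / real MQ) *
              (\<Sum>l=1..p. lam l *
                 (2 / pi * (1 / \<beta>1 k l) * arctan (1 / \<beta>1 k l) - 1 / \<beta>1 k l + 1 / 2)))))"
proof -
  interpret sss_qam_rayleigh M prior Pd Pf MI MQ P \<sigma>n p lam \<sigma> H D S h N W by (rule model)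
  have mix0: "(\<Sum>l\<in>mix_index 0. mix_weight 0 l * qam_error MI MQ (qam_beta MI MQ (P k) (mix_var 0 l))) = qam_error MI MQ (\<beta>0 k)" for k
    by (simp add: mix_index_def mix_weight_def mix_var_def \<beta>0_def)
  have mix1: "(\<Sum>l\<in>mix_index 1. mix_weight 1 l * qam_error MI MQ (qam_beta MI MQ (P k) (mix_var 1 l))) =
      (2 - 1 / real MI - 1 / real MQ) * (\<Sum>l=1..p. lam l * (1 - 1 / \<beta>1 k l))
      - 2 * (1 - 1 / real MI) * (1 - 1 / real MQ) *
        (\<Sum>l=1..p. lam l * (2 / pi * (1 / \<beta>1 k l) * arctan (1 / \<beta>1 k l) - 1 / \<beta>1 k l + 1 / 2))" for k
  proof -
    have "(\<Sum>l\<in>mix_index 1. mix_weight 1 l * qam_error MI MQ (qam_beta MI MQ (P k) (mix_var 1 l))) =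
        (\<Sum>l=1..p. lam l * qam_error MI MQ (\<beta>1 k l))"
      by (simp add: mix_index_def mix_weight_def mix_var_def \<beta>1_def)
    \<comment> \<open>Both coefficients in \<open>qam_error\<close> are independent of
      \<open>l\<close>, so the weighted sum splits into the two sums of the formula.\<close>
    also have "\<dots> = (\<Sum>l=1..p. (2 - 1 / real MI - 1 / real MQ) * (lam l * (1 - 1 / \<beta>1 k l))
        - 2 * (1 - 1 / real MI) * (1 - 1 / real MQ) *
          (lam l * (2 / pi * (1 / \<beta>1 k l) * arctan (1 / \<beta>1 k l) - 1 / \<beta>1 k l + 1 / 2)))"
      unfolding qam_error_def by (intro sum.cong refl) (simp only: right_diff_distrib mult.left_commute)
    finally show ?thesis by (simp only: sum_subtractf sum_distrib_left)
  qed
  have pair: "(\<Sum>j\<in>{0,1::nat}. g j) = g 0 + g 1" for g :: "nat \<Rightarrow> real" by simp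
  show ?thesis
    unfolding SEP_eq[OF f_density det_map output_rv]
    by (intro sum.cong refl) (simp only: pair mix0 mix1, simp only: qam_error_def)
qed

end
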